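(* Let $\sigma:\mathbb{T}^d\to\mathbb{R}^d$ be of class $\mathcal{C}^3$. Let $(x_0^\epsilon)_{\epsilon\in(0,\epsilon_0)}\subset\mathbb{T}^d$ and $(m_0^\epsilon)_{\epsilon\in(0,\epsilon_0)}\subset\mathbb{R}$ be deterministic, such that $x_0^\epsilon\to x_0^0$ as $\epsilon\to 0$ for some $x_0^0\in\mathbb{T}^d$ and $\sup_{\epsilon\in(0,\epsilon_0)}|m_0^\epsilon|<\infty$. Let $\Phi$ be a second-order integrator associated with $\sigma$ (as defined in the context). Then for all $T\in(0,\infty)$ and $p\in[1,\infty)$, there exists $C_p(T)\in(0,\infty)$ such that for all $\Delta t=T/N\in(0,\Delta t_0)$ (with $N\in\mathbb{N}$), one has \[ \sup_{\epsilon\in(0,\epsilon_0)}\Bigl(\mathbb{E}\bigl[\mathrm{d}\bigl(X_N^{\epsilon,\Delta t},X^\epsilon(T)\bigr)^p\bigr]\Bigr)^{\frac1p}\le C_p(T)\,\Delta t^{\frac12}, \] where $(X^\epsilon,m^\epsilon)$ is the solution of the multiscale SDE system and $(X_n^{\epsilon,\Delta t},m_n^{\epsilon,\Delta t})_{0\le n\le N}$ is the numerical scheme, both defined in the context.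
   Context: $d\in\mathbb{N}$, $\mathbb{T}^d=\mathbb{R}^d/\mathbb{Z}^d$ is the torus, with distance $\mathrm{d}(\cdot,\cdot)$ induced by the Euclidean norm. $\epsilon_0>0$ is an arbitrary fixed real number; $T\in(0,\infty)$; $\Delta t_0=T/N_0$ with $N_0\in\mathbb{N}$ fixed; the time-step size is $\Delta t=T/N$, $N\in\mathbb{N}$, and $t_n=n\Delta t$. $(\beta(t))_{t\ge0}$ is a standard real-valued Wiener process on a probability space satisfying the usual conditions, and $\Delta\beta_n=\beta(t_{n+1})-\beta(t_n)$. Constants do not depend on $\epsilon$ and $\Delta t$. Multiscale SDE system: $X^\epsilon(t)\in\mathbb{T}^d$, $m^\epsilon(t)\in\mathbb{R}$ solve \[ dX^\epsilon(t)=\frac{\sigma(X^\epsilon(t))m^\epsilon(t)}{\epsilon}dt,\qquad dm^\epsilon(t)=-\frac{m^\epsilon(t)}{\epsilon^2}dt+\frac1\epsilon d\beta(t), \] with $X^\epsilon(0)=x_0^\epsilon$, $m^\epsilon(0)=m_0^\epsilon$. Flow map: $\varphi:\mathbb{R}\times\mathbb{T}^d\to\mathbb{T}^d$ is the flow of the ODE $\dot x=\sigma(x)$, i.e. $\partial_t\varphi(t,x)=\sigma(\varphi(t,x))$, $\varphi(0,x)=x$. Second-order integrator: a map $\Phi:\mathbb{R}\times\mathbb{T}^d\to\mathbb{T}^d$ of class $\mathcal{C}^3$ for which there exists $C\in(0,\infty)$ such that: (i) $\mathrm{d}(\Phi(t,x),\varphi(t,x))\le C|t|^3e^{C|t|}$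 for all $t\in\mathbb{R}$, $x\in\mathbb{T}^d$; (ii) $\mathrm{d}(\Phi(t_2,x_2),\Phi(t_1,x_1))\le C(|t_2-t_1|+\mathrm{d}(x_2,x_1))e^{C(|t_1|+|t_2|)}$ for all $t_1,t_2\in\mathbb{R}$, $x_1,x_2\in\mathbb{T}^d$; (iii) for all $i,j\in\{0,1,2,3\}$ with $i+j\le3$ and all $t\in\mathbb{R}$, $\sup_{x\in\mathbb{T}^d}|\partial_t^i\partial_x^j\Phi(t,x)|\le Ce^{C|t|}$ (for $i=j=0$, where $\Phi$ is torus-valued, $|\Phi(t,x)|$ is read as $\mathrm{d}(\Phi(t,x),0)$, so the bound is automatic). Numerical scheme: \[ X_{n+1}^{\epsilon,\Delta t}=\Phi\Bigl(\frac{\Delta t\,m_{n+1}^{\epsilon,\Delta t}}{\epsilon},X_n^{\epsilon,\Delta t}\Bigr),\qquad m_{n+1}^{\epsilon,\Delta t}=m_n^{\epsilon,\Delta t}-\frac{\Delta t}{\epsilon^2}m_{n+1}^{\epsilon,\Delta t}+\frac{\Delta\beta_n}{\epsilon}, \] with $X_0^{\epsilon,\Delta t}=x_0^\epsilon$, $m_0^{\epsilon,\Delta t}=m_0^\epsilon$. *)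

theory Defs
  imports "HOL-Probability.Probability"
begin

section \<open>The flat torus\<close>

definition int_vec_rel :: "real ^ 'd \<Rightarrow> real ^ 'd \<Rightarrow> bool" where
  "int_vec_rel x y \<longleftrightarrow> (\<forall>i. x $ i - y $ i \<in> \<int>)"

lemma equivp_int_vec_rel: "equivp int_vec_rel"
proof (rule equivpI)
  show "reflp int_vec_rel"
    by (simp add: reflp_def int_vec_rel_def)
  show "symp int_vec_rel"
    unfolding symp_def int_vec_rel_def by (metis Ints_minus minus_diff_eq)
  show "transp int_vec_rel"
    unfolding transp_def int_vec_rel_def
  proof (intro allI impI)
    fix x y z :: "real ^ 'd" and i
    assume "\<forall>i. x $ i - y $ i \<in> \<int>" "\<forall>i. y $ i - z $ i \<in> \<int>"
    then have "(x $ i - y $ i) + (y $ i - z $ i) \<in> \<int>"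
      by (blast intro: Ints_add)
    then show "x $ i - z $ i \<in> \<int>" by simp
  qed
qed

quotient_type (overloaded) 'd torus = "real ^ ('d::finite)" / int_vec_rel
  morphisms rep_torus to_torus
  by (rule equivp_int_vec_rel)

lemma to_torus_eq_iff: "to_torus x = to_torus y \<longleftrightarrow> (\<forall>i. x $ i - y $ i \<in> \<int>)"
  by (simp add: torus.abs_eq_iff int_vec_rel_def)

lemma to_torus_surj: "\<exists>x. to_torus x = X"
  using Quotient_abs_rep[OF Quotient_torus] by blast

instantiation torus :: (finite) ab_group_add
begin

lift_definition zero_torus :: "'a torus" is 0 .

lift_definition plus_torus :: "'a torus \<Rightarrow> 'a torus \<Rightarrow> 'a torus" is "(+)"
  unfolding int_vec_rel_def
proof
  fix a b c e :: "real ^ 'a" and i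
  assume "\<forall>i. a $ i - b $ i \<in> \<int>" "\<forall>i. c $ i - e $ i \<in> \<int>"
  then have "(a $ i - b $ i) + (c $ i - e $ i) \<in> \<int>" by (blast intro: Ints_add)
  then show "(a + c) $ i - (b + e) $ i \<in> \<int>" by (simp add: algebra_simps)
qed

lift_definition uminus_torus :: "'a torus \<Rightarrow> 'a torus" is "uminus"
  unfolding int_vec_rel_def
proof
  fix a b :: "real ^ 'a" and i
  assume "\<forall>i. a $ i - b $ i \<in> \<int>"
  then have "- (a $ i - b $ i) \<in> \<int>" by (blast intro: Ints_minus)
  then show "(- a) $ i - (- b) $ i \<in> \<int>" by simp
qed

definition minus_torus :: "'a torus \<Rightarrow> 'a torus \<Rightarrow> 'a torus" where
  "minus_torus X Y = X + (- Y)"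

instance
proof
  fix a b c :: "'a torus"
  show "a + b + c = a + (b + c)" by transfer (simp add: int_vec_rel_def algebra_simps)
  show "a + b = b + a" by transfer (simp add: int_vec_rel_def algebra_simps)
  show "0 + a = a" by transfer (simp add: int_vec_rel_def)
  show "- a + a = 0" by transfer (simp add: int_vec_rel_def)
  show "a - b = a + - b" by (simp add: minus_torus_def)
qed

end

lemma to_torus_zero: "to_torus 0 = 0"
  by (simp add: zero_torus_def)

lemma to_torus_add: "to_torus (x + y) = to_torus x + to_torus y"
  by (simp add: plus_torus.abs_eq)

lemma to_torus_minus: "to_torus (- x) = - to_torus x"
  by (simp add: uminus_torus.abs_eq)

lemma to_torus_diff: "to_torus (x - y) = to_torus x - to_torus y"
  by (simp add: minus_torus_def flip: to_torus_add to_torus_minus)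

lemma to_torus_norm_small:
  fixes x :: "real ^ 'd"
  assumes "to_torus x = 0" "norm x < 1"
  shows "x = 0"
proof (rule vec_eq_iff[THEN iffD2], intro allI)
  fix i
  have "x $ i \<in> \<int>" using assms(1) by (simp add: to_torus_eq_iff flip: to_torus_zero)
  moreover have "\<bar>x $ i\<bar> < 1"
    using component_le_norm_cart[of x i] assms(2) by linarith
  ultimately show "x $ i = 0 $ i" by (auto elim!: Ints_cases)
qed

instantiation torus :: (finite) metric_space
begin

definition dist_torus :: "'a torus \<Rightarrow> 'a torus \<Rightarrow> real" where
  "dist_torus X Y = Inf {norm (x - y) | x y. to_torus x = X \<and> to_torus y = Y}"

definition uniformity_torus :: "('a torus \<times> 'a torus) filter" where
  "uniformity_torus = (INF e\<in>{0<..}. principal {(x, y). dist x y < e})"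

definition open_torus :: "'a torus set \<Rightarrow> bool" where
  "open_torus U \<longleftrightarrow> (\<forall>x\<in>U. \<forall>\<^sub>F (x', y) in uniformity. x' = x \<longrightarrow> y \<in> U)"

instance
proof
  have bdd: "bdd_below {norm (x - y) | x y. to_torus x = X \<and> to_torus y = Y}" for X Y :: "'a torus"
    by (rule bdd_belowI[of _ 0]) auto
  have ne: "{norm (x - y) | x y. to_torus x = X \<and> to_torus y = Y} \<noteq> {}" for X Y :: "'a torus"
    using to_torus_surj[of X] to_torus_surj[of Y] by blast
  have le: "dist (to_torus x) (to_torus y) \<le> norm (x - y)" for x y :: "real ^ 'a"
    unfolding dist_torus_def by (rule cInf_lower[OF _ bdd]) blast
  have appr: "\<exists>x y. to_torus x = X \<and> to_torus y = Y \<and> norm (x - y) < c"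
    if "dist X Y < c" for X Y :: "'a torus" and c
    using cInf_lessD[OF ne that[unfolded dist_torus_def]] by blast
  have nn: "0 \<le> dist X Y" for X Y :: "'a torus"
    unfolding dist_torus_def by (rule cInf_greatest[OF ne]) auto
  show "uniformity = (INF e\<in>{0<..}. principal {(x, y :: 'a torus). dist x y < e})"
    by (rule uniformity_torus_def)
  show "open U = (\<forall>x\<in>U. \<forall>\<^sub>F (x', y) in uniformity. x' = x \<longrightarrow> y \<in> U)" for U :: "'a torus set"
    by (rule open_torus_def)
  show "(dist X Y = 0) = (X = Y)" for X Y :: "'a torus"
  proof
    assume 0: "dist X Y = 0"
    obtain x y where xy: "to_torus x = X" "to_torus y = Y" "norm (x - y) < 1/2"
      using appr[of X Y "1/2"] 0 by auto
    show "X = Y"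
    proof (rule ccontr)
      assume "X \<noteq> Y"
      with xy have "x \<noteq> y" by blast
      then obtain u v where uv: "to_torus u = X" "to_torus v = Y" "norm (u - v) < norm (x - y)"
        using appr[of X Y "norm (x - y)"] 0 by auto
      have "to_torus ((x - y) - (u - v)) = 0"
        by (simp add: to_torus_diff xy uv)
      moreover have "norm ((x - y) - (u - v)) < 1"
        using norm_triangle_ineq4[of "x - y" "u - v"] xy(3) uv(3) by linarith
      ultimately have "(x - y) - (u - v) = 0" by (rule to_torus_norm_small)
      with uv(3) show False by simp
    qed
  next
    assume "X = Y"
    moreover obtain x where "to_torus x = X" using to_torus_surj by blast
    ultimately show "dist X Y = 0" using le[of x x] nn[of X Y] by simp
  qed
  show "dist X Y \<le> dist X Z + dist Y Z" for X Y Z :: "'a torus"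
  proof (rule field_le_epsilon)
    fix e :: real assume e: "0 < e"
    obtain x z where xz: "to_torus x = X" "to_torus z = Z" "norm (x - z) < dist X Z + e/2"
      using appr[of X Z "dist X Z + e/2"] e by auto
    obtain y w where yw: "to_torus y = Y" "to_torus w = Z" "norm (y - w) < dist Y Z + e/2"
      using appr[of Y Z "dist Y Z + e/2"] e by auto
    have "to_torus (y - w + z) = Y"
      by (simp add: to_torus_add to_torus_diff xz yw)
    then have "dist X Y \<le> norm (x - (y - w + z))"
      using le[of x "y - w + z"] xz by simp
    also have "\<dots> = norm ((x - z) - (y - w))" by (simp add: algebra_simps)
    also have "\<dots> \<le> norm (x - z) + norm (y - w)" by (rule norm_triangle_ineq4)
    finally show "dist X Y \<le> dist X Z + dist Y Z + e" using xz yw by linarith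
  qed
qed

end


section \<open>Differential calculus\<close>

text \<open>On a finite-dimensional space, \<open>f\<close> is of class $C^{k+1}$ iff it is differentiable and all
  its directional derivatives are of class $C^k$.\<close>

primrec C_k :: "nat \<Rightarrow> ('a::euclidean_space \<Rightarrow> 'b::real_normed_vector) \<Rightarrow> bool" where
  "C_k 0 f \<longleftrightarrow> continuous_on UNIV f"
| "C_k (Suc k) f \<longleftrightarrow> (\<forall>x. f differentiable (at x)) \<and>
     (\<forall>v. C_k k (\<lambda>x. frechet_derivative f (at x) v))"

primrec dderivs :: "'a list \<Rightarrow> ('a::real_normed_vector \<Rightarrow> 'b::real_normed_vector) \<Rightarrow> 'a \<Rightarrow> 'b" where
  "dderivs [] f = f"
| "dderivs (v # vs) f = dderivs vs (\<lambda>x. frechet_derivative f (at x) v)"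

definition C_k_torus :: "nat \<Rightarrow> ('d::finite torus \<Rightarrow> 'b::real_normed_vector) \<Rightarrow> bool" where
  "C_k_torus k f \<longleftrightarrow> C_k k (\<lambda>x. f (to_torus x))"

text \<open>A curve in the torus has velocity \<open>v\<close> at time \<open>t\<close> if some lift of it has. The lift
  need not be continuous away from \<open>t\<close>, so no regularity of the curve away from \<open>t\<close> is implied.\<close>

definition has_torus_derivative ::
    "(real \<Rightarrow> 'd::finite torus) \<Rightarrow> real ^ 'd \<Rightarrow> real \<Rightarrow> bool" where
  "has_torus_derivative \<gamma> v t \<longleftrightarrow>
     (\<exists>g. (\<forall>s. to_torus (g s) = \<gamma> s) \<and> (g has_vector_derivative v) (at t))"

definition torus_flow ::
    "('d::finite torus \<Rightarrow> real ^ 'd) \<Rightarrow> (real \<Rightarrow> 'd torus \<Rightarrow> 'd torus) \<Rightarrow> bool" where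
  "torus_flow \<sigma> \<phi> \<longleftrightarrow>
     (\<forall>x. \<phi> 0 x = x) \<and> (\<forall>t x. has_torus_derivative (\<lambda>s. \<phi> s x) (\<sigma> (\<phi> t x)) t)"

text \<open>A map $\mathbb{R} \times \mathbb{T}^d \to \mathbb{T}^d$ is of class $C^3$ iff it is induced by a $C^3$ map
  \<open>\<Psi>\<close> on the universal cover $\mathbb{R} \times \mathbb{R}^d$. Two such \<open>\<Psi>\<close> differ by a constant, so
  the derivatives of \<open>\<Phi>\<close> are those of \<open>\<Psi>\<close>. The operator norm of
  $\partial_t^i \partial_x^j \Phi(t,x)$ is bounded by testing on \<open>j\<close> vectors of norm at most 1.\<close>

definition second_order_integrator ::
    "(real \<Rightarrow> 'd::finite torus \<Rightarrow> 'd torus) \<Rightarrow> (real \<Rightarrow> 'd torus \<Rightarrow> 'd torus) \<Rightarrow> bool" where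
  "second_order_integrator \<phi> \<Phi> \<longleftrightarrow>
     (\<exists>\<Psi> :: real \<times> (real ^ 'd) \<Rightarrow> real ^ 'd.
        (\<forall>t x. to_torus (\<Psi> (t, x)) = \<Phi> t (to_torus x)) \<and> C_k 3 \<Psi> \<and>
        (\<exists>C>0.
           (\<forall>t x. dist (\<Phi> t x) (\<phi> t x) \<le> C * \<bar>t\<bar> ^ 3 * exp (C * \<bar>t\<bar>)) \<and>
           (\<forall>t1 t2 x1 x2. dist (\<Phi> t2 x2) (\<Phi> t1 x1)
              \<le> C * (\<bar>t2 - t1\<bar> + dist x2 x1) * exp (C * (\<bar>t1\<bar> + \<bar>t2\<bar>))) \<and>
           (\<forall>t x. dist (\<Phi> t x) 0 \<le> C * exp (C * \<bar>t\<bar>)) \<and>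
           (\<forall>i j t x vs. 1 \<le> i + j \<and> i + j \<le> 3 \<and> length vs = j \<and> (\<forall>v\<in>set vs. norm v \<le> 1) \<longrightarrow>
              norm (dderivs (map (\<lambda>v. (0, v)) vs @ replicate i (1, 0)) \<Psi> (t, x))
                \<le> C * exp (C * \<bar>t\<bar>))))"


section \<open>Stochastic setting\<close>

text \<open>Filtrations are indexed by \<open>real\<close>, but only their values at nonnegative times matter.\<close>

definition usual_conditions :: "'w measure \<Rightarrow> (real \<Rightarrow> 'w measure) \<Rightarrow> bool" where
  "usual_conditions M F \<longleftrightarrow>
     prob_space M \<and>
     filtration (space M) (\<lambda>t. F (max 0 t)) \<and>
     (\<forall>t\<ge>0. sets (F t) \<subseteq> sets M) \<and>
     (\<forall>A\<in>null_sets M. \<forall>B\<subseteq>A. B \<in> sets (F 0)) \<and>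
     (\<forall>t\<ge>0. sets (F t) = (\<Inter>s\<in>{t<..}. sets (F s)))"

definition wiener_process ::
    "'w measure \<Rightarrow> (real \<Rightarrow> 'w measure) \<Rightarrow> (real \<Rightarrow> 'w \<Rightarrow> real) \<Rightarrow> bool" where
  "wiener_process M F \<beta> \<longleftrightarrow>
     (\<forall>t\<ge>0. \<beta> t \<in> borel_measurable (F t)) \<and>
     (AE \<omega> in M. \<beta> 0 \<omega> = 0 \<and> continuous_on {0..} (\<lambda>t. \<beta> t \<omega>)) \<and>
     (\<forall>s t. 0 \<le> s \<and> s < t \<longrightarrow>
        distributed M lborel (\<lambda>\<omega>. \<beta> t \<omega> - \<beta> s \<omega>) (normal_density 0 (sqrt (t - s))) \<and>
        prob_space.indep_set M (sets (F s))
          {(\<lambda>\<omega>. \<beta> t \<omega> - \<beta> s \<omega>) -` B \<inter> space M | B. B \<in> sets borel})"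

text \<open>The system in integrated form. The noise is additive, so its stochastic integral
  $\int_0^t \epsilon^{-1} d\beta$ is $\epsilon^{-1} (\beta(t) - \beta(0))$.\<close>

definition multiscale_solution ::
    "'w measure \<Rightarrow> (real \<Rightarrow> 'w measure) \<Rightarrow> (real \<Rightarrow> 'w \<Rightarrow> real) \<Rightarrow>
     ('d::finite torus \<Rightarrow> real ^ 'd) \<Rightarrow> real \<Rightarrow> 'd torus \<Rightarrow> real \<Rightarrow>
     (real \<Rightarrow> 'w \<Rightarrow> 'd torus) \<Rightarrow> (real \<Rightarrow> 'w \<Rightarrow> real) \<Rightarrow> bool" where
  "multiscale_solution M F \<beta> \<sigma> \<epsilon> x0 m0 X m \<longleftrightarrow>
     (\<forall>t\<ge>0. X t \<in> borel_measurable (F t) \<and> m t \<in> borel_measurable (F t)) \<and>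
     (AE \<omega> in M.
        continuous_on {0..} (\<lambda>t. X t \<omega>) \<and> continuous_on {0..} (\<lambda>t. m t \<omega>) \<and>
        (\<forall>t\<ge>0.
           X t \<omega> = x0 + to_torus (integral {0..t} (\<lambda>s. (m s \<omega> / \<epsilon>) *\<^sub>R \<sigma> (X s \<omega>))) \<and>
           m t \<omega> = m0 - integral {0..t} (\<lambda>s. m s \<omega> / \<epsilon>\<^sup>2) + (\<beta> t \<omega> - \<beta> 0 \<omega>) / \<epsilon>))"

definition numerical_scheme ::
    "'w measure \<Rightarrow> (real \<Rightarrow> 'w \<Rightarrow> real) \<Rightarrow> (real \<Rightarrow> 'd::finite torus \<Rightarrow> 'd torus) \<Rightarrow>
     real \<Rightarrow> real \<Rightarrow> 'd torus \<Rightarrow> real \<Rightarrow>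
     (nat \<Rightarrow> 'w \<Rightarrow> 'd torus) \<Rightarrow> (nat \<Rightarrow> 'w \<Rightarrow> real) \<Rightarrow> bool" where
  "numerical_scheme M \<beta> \<Phi> \<epsilon> \<Delta>t x0 m0 X m \<longleftrightarrow>
     (\<forall>\<omega>\<in>space M.
        X 0 \<omega> = x0 \<and> m 0 \<omega> = m0 \<and>
        (\<forall>n. X (Suc n) \<omega> = \<Phi> (\<Delta>t * m (Suc n) \<omega> / \<epsilon>) (X n \<omega>) \<and>
             m (Suc n) \<omega> = m n \<omega> - \<Delta>t / \<epsilon>\<^sup>2 * m (Suc n) \<omega>
               + (\<beta> (real (Suc n) * \<Delta>t) \<omega> - \<beta> (real n * \<Delta>t) \<omega>) / \<epsilon>))"

end

theory Submission
  imports Defs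
begin

text \<open>Since the noise is scalar, the exact solution is the flow at a random time,
  \<open>X T = \<phi> (Z T) x0\<close> with \<open>Z T = \<integral>\<^sub>0\<^sup>T m / \<epsilon> = \<beta> T - \<beta> 0 + \<epsilon> (m0 - m T)\<close>, and the scheme composes
  integrator steps over random times \<open>\<delta> n = \<epsilon> (m\<^sub>n - m\<^sub>n\<^sub>+\<^sub>1) + \<Delta>\<beta>\<^sub>n\<close> whose partial sums telescope.
  The global error is therefore at most the sum of the local errors \<open>\<bar>\<delta> n\<bar>\<^sup>3 exp (C \<bar>\<delta> n\<bar>)\<close>, transported by
  the flow over the remaining random time, plus a multiple of \<open>\<epsilon> \<bar>m\<^sub>N - m T\<bar>\<close>. Writing \<open>\<delta> n\<close> also as
  \<open>\<Delta>t m\<^sub>n\<^sub>+\<^sub>1 / \<epsilon>\<close> and distinguishing whether \<open>\<epsilon> \<le> sqrt \<Delta>t\<close> gives \<open>\<delta> n = O(sqrt \<Delta>t)\<close> uniformly in \<open>\<epsilon>\<close>, so that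
  the \<open>N\<close> local errors add up to \<open>O(sqrt \<Delta>t)\<close>.

  All moments are controlled through exponential moments. Those of \<open>m\<^sub>n\<close> follow by induction from
  the independence of the increments and pass to \<open>m t\<close> by Fatou's lemma. The rescaled error
  \<open>\<epsilon> (m t - m\<^sub>n) / sqrt \<Delta>t\<close> is at each step a convex combination of its previous value and of a time
  average of rescaled increments of \<open>\<epsilon> m\<close>, and convexity of \<open>exp\<close> propagates the bound.\<close>

section \<open>Lipschitz fields on the torus and their flows\<close>

lemma dist_to_torus_le: "dist (to_torus x) (to_torus y) \<le> norm (x - y)"
  unfolding dist_torus_def by (rule cInf_lower) (auto intro!: bdd_belowI[of _ 0])

text \<open>The torus distance is an infimum over lifts. A strict bound avoids showing that it is
  attained; later uses absorb the slack in an arbitrary \<open>e\<close>.\<close>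

lemma dist_torus_lifts:
  assumes "dist X Y < c"
  obtains x y where "to_torus x = X" "to_torus y = Y" "norm (x - y) < c"
proof -
  have "{norm (x - y) | x y. to_torus x = X \<and> to_torus y = Y} \<noteq> {}"
    using to_torus_surj[of X] to_torus_surj[of Y] by blast
  from cInf_lessD[OF this assms[unfolded dist_torus_def]] that show ?thesis by blast
qed

text \<open>Componentwise fractional parts move any point into the unit cube without changing the
  value of \<open>f\<close>, and a continuous function is bounded on that compact set.\<close>

lemma torus_periodic_bounded:
  fixes f :: "real ^ 'd::finite \<Rightarrow> 'b::real_normed_vector"
  assumes "continuous_on UNIV f" and per: "\<And>x y. to_torus x = to_torus y \<Longrightarrow> f x = f y"
  obtains B where "0 \<le> B" "\<And>x. norm (f x) \<le> B"
proof -
  have "compact (f ` cbox 0 1)"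
    by (rule compact_continuous_image) (auto intro: continuous_on_subset[OF assms(1)])
  then obtain B where B: "\<forall>y\<in>f ` cbox 0 1. norm y \<le> B"
    using compact_imp_bounded bounded_iff by metis
  have "norm (f x) \<le> B" for x
  proof -
    define y :: "real ^ 'd" where "y = (\<chi> i. frac (x $ i))"
    have "to_torus y = to_torus x"
      by (simp add: to_torus_eq_iff y_def frac_def)
    moreover have "y \<in> cbox 0 1"
      by (auto simp: mem_box_cart y_def intro: less_imp_le[OF frac_lt_1])
    ultimately show ?thesis using per B by (metis imageI)
  qed
  moreover from this[of 0] have "0 \<le> B" using norm_ge_zero order_trans by blast
  ultimately show ?thesis using that by blast
qed

lemma C_k_imp_continuous: "C_k k f \<Longrightarrow> continuous_on UNIV f"
  by (cases k)
    (auto simp: continuous_on_eq_continuous_at dest: differentiable_imp_continuous_within)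

text \<open>As \<open>frechet_derivative\<close> is a choice operator, it suffices that the same
  maps are derivatives of \<open>f\<close> at both points. This follows from the chain rule for a
  translation and its inverse.\<close>

lemma frechet_derivative_translate:
  assumes "\<And>x. f (x + c) = f x"
  shows "frechet_derivative f (at (x + c)) = frechet_derivative f (at x)"
proof -
  have "(f has_derivative D) (at (x + c)) \<longleftrightarrow> (f has_derivative D) (at x)" for D
  proof -
    have "((\<lambda>x. f (x + c)) has_derivative D) (at x)" if "(f has_derivative D) (at (x + c))" for x c
    proof -
      have "((\<lambda>x. x + c) has_derivative (\<lambda>h. h)) (at x)"
        by (auto intro!: derivative_eq_intros)
      from diff_chain_at[OF this, of f D] that show ?thesis by (simp add: o_def)
    qed
    from this[of x c] this[of "x + c" "- c"] show ?thesis
      using assms assms[of "_ - c"] by auto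
  qed
  then show ?thesis unfolding frechet_derivative_def by simp
qed

text \<open>The directional derivatives are continuous and periodic, hence bounded; summing over the
  basis bounds the operator norm, and the mean value inequality applies. The bound is phrased for
  lifts because integral curves are compared there.\<close>

lemma C_k_torus_lipschitz:
  fixes \<sigma> :: "'d::finite torus \<Rightarrow> real ^ 'd"
  assumes "C_k_torus (Suc k) \<sigma>"
  obtains L where "0 \<le> L" "\<And>x y. norm (\<sigma> (to_torus x) - \<sigma> (to_torus y)) \<le> L * norm (x - y)"
proof -
  define f where "f = (\<lambda>x. \<sigma> (to_torus x))"
  define D where "D x = frechet_derivative f (at x)" for x
  have diff: "\<And>x. f differentiable (at x)" and cont: "\<And>v. continuous_on UNIV (\<lambda>x. D x v)"
    using assms by (auto simp: C_k_torus_def f_def D_def intro: C_k_imp_continuous)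
  have der: "(f has_derivative D x) (at x)" for x
    using diff[of x] frechet_derivative_works D_def by metis
  have "D x = D y" if "to_torus x = to_torus y" for x y
  proof -
    have "to_torus (x - y) = 0" using that by (simp add: to_torus_diff)
    then have "f (z + (x - y)) = f z" for z by (simp add: f_def to_torus_add)
    from frechet_derivative_translate[of f "x - y" y, OF this] show ?thesis by (simp add: D_def)
  qed
  then have "\<exists>B. \<forall>x. norm (D x v) \<le> B" for v
    using torus_periodic_bounded[OF cont[of v]] by metis
  then obtain B where B: "\<And>v x. norm (D x v) \<le> B v" by metis
  define L where "L = (\<Sum>e\<in>Basis. B e)"
  have lip: "norm (f x - f y) \<le> L * norm (x - y)" for x y
  proof (rule differentiable_bound[OF convex_UNIV, of f D])
    show "(f has_derivative D x) (at x within UNIV)" for x using der by simp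
    show "onorm (D x) \<le> L" for x
    proof (rule onorm_bound)
      show "0 \<le> L" unfolding L_def using B norm_ge_zero order_trans by (intro sum_nonneg) blast
      show "norm (D x h) \<le> L * norm h" for h
      proof -
        have lin: "linear (D x)" using der has_derivative_linear by blast
        have "D x h = D x (\<Sum>e\<in>Basis. (h \<bullet> e) *\<^sub>R e)" by (simp add: euclidean_representation)
        also have "\<dots> = (\<Sum>e\<in>Basis. (h \<bullet> e) *\<^sub>R D x e)"
          by (simp add: linear_sum[OF lin] linear_cmul[OF lin])
        also have "norm \<dots> \<le> (\<Sum>e\<in>Basis. norm h * B e)"
          by (intro order_trans[OF norm_sum] sum_mono)
            (auto intro!: mult_mono B Basis_le_norm)
        finally show ?thesis by (simp add: L_def sum_distrib_left mult.commute)
      qed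
    qed
  qed auto
  have "0 \<le> L" unfolding L_def using B norm_ge_zero order_trans by (intro sum_nonneg) blast
  with lip that show ?thesis by (auto simp: f_def)
qed

text \<open>The velocity determines the curve: the distance between the curve and the projected
  antiderivative has derivative 0.\<close>

lemma torus_curve_eq_projection:
  assumes \<gamma>: "\<And>t. has_torus_derivative \<gamma> (v t) t"
    and y: "\<And>t. (y has_vector_derivative v t) (at t)" and 0: "to_torus (y 0) = \<gamma> 0"
  shows "to_torus (y t) = \<gamma> t"
proof -
  define f where "f t = dist (\<gamma> t - to_torus (y t)) 0" for t
  have "DERIV f t :> 0" for t
  proof -
    \<comment> \<open>This lift depends on \<open>t\<close> and may be discontinuous elsewhere, so
      it serves only for the difference quotient of \<open>f\<close> at \<open>t\<close>.\<close>
    obtain g where g: "\<And>s. to_torus (g s) = \<gamma> s" "(g has_vector_derivative v t) (at t)"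
      using \<gamma>[of t] unfolding has_torus_derivative_def by blast
    define k where "k s = g s - y s" for s
    have "(k has_vector_derivative v t - v t) (at t)"
      unfolding k_def by (intro derivative_intros g y)
    then have "(k has_derivative (\<lambda>_. 0)) (at t)" by (simp add: has_vector_derivative_def)
    then have lim: "((\<lambda>s. norm (k s - k t) / norm (s - t)) \<longlongrightarrow> 0) (at t)"
      by (simp add: has_derivative_iff_norm)
    have le: "\<bar>f s - f t\<bar> \<le> norm (k s - k t)" for s
    proof -
      have *: "\<gamma> s - to_torus (y s) = to_torus (k s)" for s by (simp add: k_def to_torus_diff g)
      have "\<bar>f s - f t\<bar> \<le> dist (to_torus (k s)) (to_torus (k t))"
        unfolding f_def * using abs_dist_diff_le[of "to_torus (k s)" 0 "to_torus (k t)"] 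
        by (simp add: dist_commute)
      also have "\<dots> \<le> norm (k s - k t)" by (rule dist_to_torus_le)
      finally show ?thesis .
    qed
    have "(f has_derivative (\<lambda>_. 0)) (at t)"
      unfolding has_derivative_iff_norm
    proof
      show "((\<lambda>s. norm (f s - f t - 0) / norm (s - t)) \<longlongrightarrow> 0) (at t within UNIV)"
        by (rule tendsto_sandwich[OF _ _ tendsto_const lim])
          (auto intro!: always_eventually divide_right_mono le)
    qed simp
    then show ?thesis by (rule has_derivative_imp_has_field_derivative) simp
  qed
  then have "f t = f 0" using DERIV_isconst_all by blast
  then show ?thesis by (simp add: f_def 0)
qed

lemma has_torus_derivative_imp_isCont:
  assumes "has_torus_derivative \<gamma> v t"
  shows "isCont \<gamma> t"
proof -
  obtain g where g: "\<And>s. to_torus (g s) = \<gamma> s" "(g has_vector_derivative v) (at t)"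
    using assms unfolding has_torus_derivative_def by blast
  have "isCont g t" using g(2) has_vector_derivative_continuous by blast
  then have "((\<lambda>s. norm (g s - g t)) \<longlongrightarrow> 0) (at t)"
    by (simp add: isCont_def LIM_zero tendsto_norm_zero)
  moreover have "dist (\<gamma> s) (\<gamma> t) \<le> norm (g s - g t)" for s
    unfolding g(1)[symmetric] by (rule dist_to_torus_le)
  ultimately have "((\<lambda>s. dist (\<gamma> s) (\<gamma> t)) \<longlongrightarrow> 0) (at t)"
    using tendsto_sandwich[OF _ _ tendsto_const, of 0 "\<lambda>s. dist (\<gamma> s) (\<gamma> t)" "at t" "\<lambda>s. norm (g s - g t)"]
    by (simp add: always_eventually)
  then show ?thesis unfolding isCont_def by (rule tendsto_dist_iff[THEN iffD2])
qed

lemma lipschitz_lift_imp_lipschitz: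
  fixes f :: "'d::finite torus \<Rightarrow> 'b::real_normed_vector"
  assumes "0 \<le> L" "\<And>x y. norm (f (to_torus x) - f (to_torus y)) \<le> L * norm (x - y)"
  shows "norm (f X - f Y) \<le> L * dist X Y"
proof (rule field_le_epsilon)
  fix e :: real assume e: "0 < e"
  \<comment> \<open>Dividing the slack by \<open>L + 1\<close> rather than \<open>L\<close> covers
    the case \<open>L = 0\<close>.\<close>
  obtain x y where xy: "to_torus x = X" "to_torus y = Y" "norm (x - y) < dist X Y + e / (L + 1)"
    using dist_torus_lifts[of X Y "dist X Y + e / (L + 1)"] e assms(1) by auto
  have "norm (f X - f Y) \<le> L * norm (x - y)" using assms(2)[of x y] xy by simp
  also have "\<dots> \<le> L * (dist X Y + e / (L + 1))" using xy assms(1) by (intro mult_left_mono) auto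
  also have "\<dots> \<le> L * dist X Y + e" using e assms(1) by (simp add: field_simps)
  finally show "norm (f X - f Y) \<le> L * dist X Y + e" .
qed

text \<open>Gronwall's argument: the squared distance, damped by \<open>exp (- 2 * L * A t)\<close>
  with \<open>A\<close> the total variation of the time change, is nonincreasing. One statement
  covers both time directions of the flow (rates \<open>1\<close> and \<open>- 1\<close>) and the
  random time change of the exact solution.\<close>

lemma time_changed_flow_comparison:
  fixes u v :: "real \<Rightarrow> 'a::euclidean_space"
  assumes T: "0 \<le> T" and a: "continuous_on {0..T} a" and L: "0 \<le> L"
    and lip: "\<And>x y. norm (s x - s y) \<le> L * norm (x - y)"
    and u: "\<And>t. t \<in> {0..T} \<Longrightarrow> (u has_vector_derivative a t *\<^sub>R s (u t)) (at t within {0..T})"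
    and v: "\<And>t. t \<in> {0..T} \<Longrightarrow> (v has_vector_derivative a t *\<^sub>R s (v t)) (at t within {0..T})"
  shows "norm (u T - v T) \<le> norm (u 0 - v 0) * exp (L * integral {0..T} (\<lambda>t. \<bar>a t\<bar>))"
proof -
  define A where "A t = integral {0..t} (\<lambda>t. \<bar>a t\<bar>)" for t
  define w where "w t = exp (- 2 * L * A t) * ((u t - v t) \<bullet> (u t - v t))" for t
  have A: "(A has_vector_derivative \<bar>a t\<bar>) (at t within {0..T})" if "t \<in> {0..T}" for t
    unfolding A_def by (rule integral_has_vector_derivative) (use a that in \<open>auto intro!: continuous_intros\<close>)
  have w: "(w has_vector_derivative
      exp (- 2 * L * A t) * (2 * ((u t - v t) \<bullet> (a t *\<^sub>R s (u t) - a t *\<^sub>R s (v t)))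
         - 2 * L * \<bar>a t\<bar> * ((u t - v t) \<bullet> (u t - v t)))) (at t within {0..T})"
    if "t \<in> {0..T}" for t
    unfolding w_def has_vector_derivative_def
    by (rule derivative_eq_intros u[OF that, unfolded has_vector_derivative_def]
        v[OF that, unfolded has_vector_derivative_def] 
        A[OF that, unfolded has_vector_derivative_def] refl)+
      (auto simp: algebra_simps inner_commute fun_eq_iff)
  have "w 0 \<ge> w T"
  proof (rule DERIV_nonpos_imp_decreasing_open[OF T])
    show "continuous_on {0..T} w"
      using w has_vector_derivative_continuous by (metis continuous_on_eq_continuous_within)
    fix t assume t: "0 < t" "t < T"
    have "(u t - v t) \<bullet> (a t *\<^sub>R s (u t) - a t *\<^sub>R s (v t)) \<le> L * \<bar>a t\<bar> * ((u t - v t) \<bullet> (u t - v t))"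
    proof -
      have "(u t - v t) \<bullet> (a t *\<^sub>R s (u t) - a t *\<^sub>R s (v t))
          \<le> norm (u t - v t) * norm (a t *\<^sub>R s (u t) - a t *\<^sub>R s (v t))"
        by (rule norm_cauchy_schwarz)
      also have "\<dots> = norm (u t - v t) * (\<bar>a t\<bar> * norm (s (u t) - s (v t)))"
        by (simp flip: scaleR_diff_right)
      also have "\<dots> \<le> norm (u t - v t) * (\<bar>a t\<bar> * (L * norm (u t - v t)))"
        by (intro mult_left_mono lip) auto
      finally show ?thesis by (simp add: dot_square_norm power2_eq_square mult_ac)
    qed
    moreover have "(w has_vector_derivative
      exp (- 2 * L * A t) * (2 * ((u t - v t) \<bullet> (a t *\<^sub>R s (u t) - a t *\<^sub>R s (v t)))
         - 2 * L * \<bar>a t\<bar> * ((u t - v t) \<bullet> (u t - v t)))) (at t)"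
      using w[of t] t at_within_Icc_at[of 0 t T] by simp
    ultimately show "\<exists>y. DERIV w t :> y \<and> y \<le> 0"
      by (auto simp: has_real_derivative_iff_has_vector_derivative mult_le_0_iff intro!: exI)
  qed
  then have "(norm (u T - v T))\<^sup>2 \<le> (norm (u 0 - v 0) * exp (L * A T))\<^sup>2"
    by (simp add: w_def A_def dot_square_norm exp_minus field_simps power_mult_distrib
        flip: exp_double)
  then show ?thesis unfolding A_def by (rule power2_le_imp_le) simp
qed

section \<open>The flow of a bounded Lipschitz field\<close>

locale lipschitz_torus_flow =
  fixes \<sigma> :: "'d::finite torus \<Rightarrow> real ^ 'd" and \<phi> :: "real \<Rightarrow> 'd torus \<Rightarrow> 'd torus" and L B :: real
  assumes flow: "torus_flow \<sigma> \<phi>"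
    and L_nonneg: "0 \<le> L"
    and lipschitz: "\<And>x y. norm (\<sigma> (to_torus x) - \<sigma> (to_torus y)) \<le> L * norm (x - y)"
    and B_nonneg: "0 \<le> B" and bounded: "\<And>x. norm (\<sigma> x) \<le> B"
begin

lemma continuous_on_field: "continuous_on UNIV \<sigma>"
proof (rule lipschitz_on_continuous_on)
  have "dist (\<sigma> X) (\<sigma> Y) \<le> L * dist X Y" for X Y
    unfolding dist_norm by (rule lipschitz_lift_imp_lipschitz[OF L_nonneg lipschitz])
  then show "L-lipschitz_on UNIV \<sigma>" by (intro lipschitz_onI L_nonneg) auto
qed

text \<open>\<open>has_torus_derivative\<close> offers lifts that are good at a single time only. A
  global differentiable lift arises by integrating the velocity, which is continuous along the
  curve, and \<open>torus_curve_eq_projection\<close> identifies its projection with the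
  flow.\<close>

lemma flow_lift:
  obtains y where "y 0 = x" "\<And>t. to_torus (y t) = \<phi> t (to_torus x)"
    "\<And>t. (y has_vector_derivative \<sigma> (to_torus (y t))) (at t)"
proof -
  let ?\<gamma> = "\<lambda>t. \<phi> t (to_torus x)"
  have \<gamma>: "\<And>t. has_torus_derivative ?\<gamma> (\<sigma> (?\<gamma> t)) t" and \<gamma>0: "?\<gamma> 0 = to_torus x"
    using flow unfolding torus_flow_def by auto
  have "isCont (\<lambda>t. \<sigma> (?\<gamma> t)) t" for t
    by (rule isCont_o2[OF has_torus_derivative_imp_isCont[OF \<gamma>]])
      (use continuous_on_field in \<open>simp add: continuous_on_eq_continuous_at\<close>)
  then obtain G where G: "\<And>t. (G has_vector_derivative \<sigma> (?\<gamma> t)) (at t)"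
    using einterval_antiderivative[of "-\<infinity>" "\<infinity>" "\<lambda>t. \<sigma> (?\<gamma> t)"] by auto
  define y where "y t = x + (G t - G 0)" for t
  have y: "(y has_vector_derivative \<sigma> (?\<gamma> t)) (at t)" for t
    unfolding y_def using G[of t] by (auto intro!: derivative_eq_intros)
  moreover have y\<gamma>: "to_torus (y t) = ?\<gamma> t" for t
    by (rule torus_curve_eq_projection[OF \<gamma> y]) (simp add: y_def \<gamma>0)
  ultimately show ?thesis by (intro that[of y]) (auto simp: y_def)
qed

lemma integral_curves_comparison:
  fixes u v :: "real \<Rightarrow> real ^ 'd"
  assumes u: "\<And>t. (u has_vector_derivative \<sigma> (to_torus (u t))) (at t)"
    and v: "\<And>t. (v has_vector_derivative \<sigma> (to_torus (v t))) (at t)"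
  shows "norm (u t - v t) \<le> norm (u 0 - v 0) * exp (L * \<bar>t\<bar>)"
proof (cases "0 \<le> t")
  case True
  have "norm (u t - v t) \<le> norm (u 0 - v 0) * exp (L * integral {0..t} (\<lambda>t. \<bar>1::real\<bar>))"
    by (rule time_changed_flow_comparison[where s = "\<lambda>x. \<sigma> (to_torus x)"])
      (use True L_nonneg lipschitz u v in \<open>auto intro: has_vector_derivative_at_within\<close>)
  then show ?thesis using True by simp
next
  case False
  \<comment> \<open>Negative times reduce to positive ones: reversed curves solve the equation with
    rate \<open>- 1\<close>.\<close>
  have rev: "((\<lambda>t. w (- t)) has_vector_derivative - 1 *\<^sub>R \<sigma> (to_torus (w (- t)))) (at t within S)"
    if "\<And>t. (w has_vector_derivative \<sigma> (to_torus (w t))) (at t)" for w :: "real \<Rightarrow> real ^ 'd" and t S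
  proof -
    have "(uminus has_vector_derivative - 1) (at t)"
      by (auto intro!: derivative_eq_intros)
    from vector_diff_chain_at[OF this that[of "- t"]] show ?thesis
      by (simp add: o_def has_vector_derivative_at_within)
  qed
  have "norm (u (- (- t)) - v (- (- t)))
      \<le> norm (u (- 0) - v (- 0)) * exp (L * integral {0..- t} (\<lambda>t. \<bar>- 1::real\<bar>))"
    by (rule time_changed_flow_comparison[where s = "\<lambda>x. \<sigma> (to_torus x)" and a = "\<lambda>_. - 1"
          and u = "\<lambda>t. u (- t)" and v = "\<lambda>t. v (- t)"])
      (use False L_nonneg lipschitz rev[OF u] rev[OF v] in auto)
  then show ?thesis using False by simp
qed

text \<open>Uniqueness: a lift of the restarted curve and the shifted lift of the original one solve
  the same equation from the same point, so the comparison bound between them is 0.\<close>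

lemma flow_add: "\<phi> s (\<phi> t X) = \<phi> (s + t) X"
proof -
  obtain x where x: "to_torus x = X" using to_torus_surj by blast
  obtain y where y: "\<And>t. to_torus (y t) = \<phi> t X"
    "\<And>t. (y has_vector_derivative \<sigma> (to_torus (y t))) (at t)"
    using flow_lift[of x] x by metis
  obtain u where u: "u 0 = y t" "\<And>s. to_torus (u s) = \<phi> s (to_torus (y t))"
    "\<And>s. (u has_vector_derivative \<sigma> (to_torus (u s))) (at s)"
    using flow_lift[of "y t"] by metis
  have v: "((\<lambda>s. y (s + t)) has_vector_derivative \<sigma> (to_torus (y (s + t)))) (at s)" for s
  proof -
    have "((\<lambda>s. s + t) has_vector_derivative 1) (at s)"
      by (auto intro!: derivative_eq_intros)
    from vector_diff_chain_at[OF this y(2)[of "s + t"]] show ?thesis by (simp add: o_def)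
  qed
  have "u s = y (s + t)"
    using integral_curves_comparison[OF u(3) v, of s] u(1) by simp
  then show ?thesis using u(2) y(1) by metis
qed

lemma flow_lipschitz_space: "dist (\<phi> t X) (\<phi> t Y) \<le> exp (L * \<bar>t\<bar>) * dist X Y"
proof -
  let ?c = "exp (L * \<bar>t\<bar>)"
  \<comment> \<open>Dividing by the growth factor first makes the slack from the choice of lifts
    exactly \<open>e\<close>.\<close>
  have "dist (\<phi> t X) (\<phi> t Y) / ?c \<le> dist X Y + e" if e: "0 < e" for e
  proof -
    obtain x y where xy: "to_torus x = X" "to_torus y = Y" "norm (x - y) < dist X Y + e"
      using dist_torus_lifts[of X Y "dist X Y + e"] e by auto
    obtain u where u: "u 0 = x" "\<And>t. to_torus (u t) = \<phi> t X"
      "\<And>t. (u has_vector_derivative \<sigma> (to_torus (u t))) (at t)"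
      using flow_lift[of x] xy by metis
    obtain v where v: "v 0 = y" "\<And>t. to_torus (v t) = \<phi> t Y"
      "\<And>t. (v has_vector_derivative \<sigma> (to_torus (v t))) (at t)"
      using flow_lift[of y] xy by metis
    have "dist (\<phi> t X) (\<phi> t Y) \<le> norm (u t - v t)"
      unfolding u(2)[symmetric] v(2)[symmetric] by (rule dist_to_torus_le)
    also have "\<dots> \<le> norm (x - y) * ?c"
      using integral_curves_comparison[OF u(3) v(3)] u(1) v(1) by simp
    finally have "dist (\<phi> t X) (\<phi> t Y) / ?c \<le> norm (x - y)" by (simp add: field_simps)
    then show ?thesis using xy(3) by linarith
  qed
  then have "dist (\<phi> t X) (\<phi> t Y) / ?c \<le> dist X Y" by (rule field_le_epsilon)
  then show ?thesis by (simp add: field_simps)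
qed

lemma flow_lipschitz_time: "dist (\<phi> s X) (\<phi> t X) \<le> B * \<bar>s - t\<bar>"
proof -
  obtain x where x: "to_torus x = X" using to_torus_surj by blast
  obtain y where y: "\<And>t. to_torus (y t) = \<phi> t X"
    "\<And>t. (y has_vector_derivative \<sigma> (to_torus (y t))) (at t)"
    using flow_lift[of x] x by metis
  have "norm (y s - y t) \<le> B * norm (s - t)"
  proof (rule differentiable_bound[OF convex_UNIV])
    show "(y has_derivative (\<lambda>h. h *\<^sub>R \<sigma> (to_torus (y r)))) (at r within UNIV)" for r
      using y(2)[of r] by (simp add: has_vector_derivative_def)
    show "onorm (\<lambda>h. h *\<^sub>R \<sigma> (to_torus (y r))) \<le> B" for r
      by (rule onorm_bound) (auto simp: B_nonneg intro: order_trans[OF mult_left_mono[OF bounded]] simp: mult.commute)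
  qed auto
  with dist_to_torus_le[of "y s" "y t"] show ?thesis by (simp add: y(1))
qed

text \<open>A scalar rate only changes the speed along integral curves: the lift \<open>u\<close> of
  \<open>X\<close> and the curve \<open>y (A t)\<close> solve the same nonautonomous equation from
  the same point, so the comparison estimate forces them to agree.\<close>

lemma time_changed_solution_eq_flow:
  fixes a :: "real \<Rightarrow> real"
  assumes T: "0 \<le> T" and X: "continuous_on {0..T} X" and a: "continuous_on {0..T} a"
    and sol: "\<And>t. t \<in> {0..T} \<Longrightarrow> X t = x0 + to_torus (integral {0..t} (\<lambda>s. a s *\<^sub>R \<sigma> (X s)))"
  shows "X T = \<phi> (integral {0..T} a) x0"
proof -
  obtain x where x: "to_torus x = x0" using to_torus_surj by blast
  obtain y where y: "y 0 = x" "\<And>t. to_torus (y t) = \<phi> t x0"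
    "\<And>t. (y has_vector_derivative \<sigma> (to_torus (y t))) (at t)"
    using flow_lift[of x] x by metis
  define u where "u t = x + integral {0..t} (\<lambda>s. a s *\<^sub>R \<sigma> (X s))" for t
  define A where "A t = integral {0..t} a" for t
  have uX: "to_torus (u t) = X t" if "t \<in> {0..T}" for t
    using sol[OF that] by (simp add: u_def to_torus_add x)
  have u: "(u has_vector_derivative a t *\<^sub>R \<sigma> (to_torus (u t))) (at t within {0..T})"
    if t: "t \<in> {0..T}" for t
  proof -
    have "((\<lambda>t. integral {0..t} (\<lambda>s. a s *\<^sub>R \<sigma> (X s))) has_vector_derivative a t *\<^sub>R \<sigma> (X t))
        (at t within {0..T})"
      by (rule integral_has_vector_derivative[OF _ t])
        (intro continuous_intros a continuous_on_compose2[OF continuous_on_field X] subset_UNIV)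
    then have "(u has_vector_derivative a t *\<^sub>R \<sigma> (X t)) (at t within {0..T})"
      unfolding u_def by (auto intro!: derivative_eq_intros)
    then show ?thesis by (simp only: uX[OF t])
  qed
  have v: "((\<lambda>t. y (A t)) has_vector_derivative a t *\<^sub>R \<sigma> (to_torus (y (A t)))) (at t within {0..T})"
    if t: "t \<in> {0..T}" for t
  proof -
    have "(A has_vector_derivative a t) (at t within {0..T})"
      unfolding A_def by (rule integral_has_vector_derivative[OF a t])
    from vector_diff_chain_within[OF this has_vector_derivative_at_within[OF y(3)[of "A t"]]]
    show ?thesis by (simp add: o_def)
  qed
  have "norm (u T - y (A T)) \<le> norm (u 0 - y (A 0)) * exp (L * integral {0..T} (\<lambda>t. \<bar>a t\<bar>))"
    by (rule time_changed_flow_comparison[OF T a L_nonneg lipschitz u v])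
  then have "u T = y (A T)" by (simp add: u_def A_def y(1))
  then show ?thesis using uX[of T] y(2) T by (simp add: A_def)
qed

text \<open>A telescoping sum over the step at which the numerical path is replaced by the exact
  flow. By \<open>flow_add\<close>, consecutive terms differ by one local error, which the spatial
  Lipschitz bound transports over the remaining time.\<close>

lemma integrator_global_error:
  assumes local_error: "\<And>t x. dist (\<Phi> t x) (\<phi> t x) \<le> C * \<bar>t\<bar> ^ 3 * exp (C * \<bar>t\<bar>)"
    and X: "\<And>n. X (Suc n) = \<Phi> (\<delta> n) (X n)"
  shows "dist (X N) (\<phi> (\<Sum>n<N. \<delta> n) (X 0))
    \<le> (\<Sum>n<N. C * \<bar>\<delta> n\<bar> ^ 3 * exp (C * \<bar>\<delta> n\<bar>) * exp (L * \<bar>\<Sum>k\<in>{Suc n..<N}. \<delta> k\<bar>))"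
proof -
  \<comment> \<open>\<open>A k\<close> makes \<open>k\<close> integrator steps and then follows the
    exact flow for the remaining time: \<open>A N\<close> is the numerical result,
    \<open>A 0\<close> the flow over the total time.\<close>
  define A where "A k = \<phi> (\<Sum>j\<in>{k..<N}. \<delta> j) (X k)" for k
  have step: "dist (A (Suc k)) (A k)
      \<le> C * \<bar>\<delta> k\<bar> ^ 3 * exp (C * \<bar>\<delta> k\<bar>) * exp (L * \<bar>\<Sum>j\<in>{Suc k..<N}. \<delta> j\<bar>)"
    if "k < N" for k
  proof -
    let ?S = "\<Sum>j\<in>{Suc k..<N}. \<delta> j"
    have "A k = \<phi> ?S (\<phi> (\<delta> k) (X k))"
      using that by (simp add: A_def flow_add sum.atLeast_Suc_lessThan add.commute)
    then have "dist (A (Suc k)) (A k) = dist (\<phi> ?S (\<Phi> (\<delta> k) (X k))) (\<phi> ?S (\<phi> (\<delta> k) (X k)))"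
      by (simp add: A_def X)
    also have "\<dots> \<le> exp (L * \<bar>?S\<bar>) * dist (\<Phi> (\<delta> k) (X k)) (\<phi> (\<delta> k) (X k))"
      by (rule flow_lipschitz_space)
    also have "\<dots> \<le> exp (L * \<bar>?S\<bar>) * (C * \<bar>\<delta> k\<bar> ^ 3 * exp (C * \<bar>\<delta> k\<bar>))"
      by (intro mult_left_mono local_error) auto
    finally show ?thesis by (simp add: mult.commute)
  qed
  have "dist (A n) (A 0)
      \<le> (\<Sum>k<n. C * \<bar>\<delta> k\<bar> ^ 3 * exp (C * \<bar>\<delta> k\<bar>) * exp (L * \<bar>\<Sum>j\<in>{Suc k..<N}. \<delta> j\<bar>))"
    if "n \<le> N" for n
    using that
  proof (induction n)
    case (Suc n)
    then show ?case
      using step[of n] dist_triangle[of "A (Suc n)" "A 0" "A n"] by fastforce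
  qed simp
  moreover have "\<phi> 0 x = x" for x using flow by (simp add: torus_flow_def)
  ultimately show ?thesis by (force simp: A_def lessThan_atLeast0)
qed

end

section \<open>Exponential moments\<close>

text \<open>All exponential orders are tracked because local errors and their transport grow
  exponentially in the random times. The function \<open>\<kappa>\<close> holds all constants:
  uniformity in time, step size and \<open>\<epsilon>\<close> means that a single
  \<open>\<kappa>\<close> serves for all of them.\<close>

definition exp_moments_le :: "'w measure \<Rightarrow> ('w \<Rightarrow> real) \<Rightarrow> (real \<Rightarrow> real) \<Rightarrow> bool" where
  "exp_moments_le M Y \<kappa> \<longleftrightarrow> Y \<in> borel_measurable M \<and>
     (\<forall>c\<ge>0. (\<integral>\<^sup>+\<omega>. ennreal (exp (c * \<bar>Y \<omega>\<bar>)) \<partial>M) \<le> ennreal (\<kappa> c))"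

text \<open>The bound for a Gaussian variable with mean at most \<open>K\<close> in absolute value
  and variance at most 1; the factor 2 pays for the two signs inside the absolute value.\<close>

definition gaussian_moments :: "real \<Rightarrow> real \<Rightarrow> real" where
  "gaussian_moments K c = 2 * exp (c * K + c\<^sup>2 / 2)"

lemma exp_moments_leD:
  assumes "exp_moments_le M Y \<kappa>"
  shows "Y \<in> borel_measurable M"
    and "0 \<le> c \<Longrightarrow> (\<integral>\<^sup>+\<omega>. ennreal (exp (c * \<bar>Y \<omega>\<bar>)) \<partial>M) \<le> ennreal (\<kappa> c)"
  using assms by (auto simp: exp_moments_le_def)

text \<open>Stands in for Hoelder's inequality when exponential moments of sums are bounded: no
  independence enters, and the price is a doubled exponent.\<close>

lemma exp_add_le: "exp (a + b) \<le> exp (2 * a) + exp (2 * b)" for a b :: real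
proof (cases "a \<le> b")
  case True
  then have "exp (a + b) \<le> exp (2 * b)" by simp
  then show ?thesis by (simp add: add_increasing)
next
  case False
  then have "exp (a + b) \<le> exp (2 * a)" by simp
  then show ?thesis by (simp add: add_increasing2)
qed

context prob_space
begin

text \<open>The integrand is at least 1 on a probability space. The consequence used later is that
  \<open>\<kappa> c\<close> is nonnegative, so that sums and products of bounds pass between
  \<open>ennreal\<close> and \<open>real\<close>.\<close>

lemma exp_moments_le_ge_1:
  assumes "exp_moments_le M Y \<kappa>" "0 \<le> c"
  shows "1 \<le> \<kappa> c"
proof -
  have "1 = (\<integral>\<^sup>+\<omega>. 1 \<partial>M)" by (simp add: emeasure_space_1)
  also have "\<dots> \<le> (\<integral>\<^sup>+\<omega>. ennreal (exp (c * \<bar>Y \<omega>\<bar>)) \<partial>M)"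
    using assms(2) by (intro nn_integral_mono) (simp flip: ennreal_1)
  also have "\<dots> \<le> ennreal (\<kappa> c)" by (rule exp_moments_leD(2)[OF assms])
  finally show ?thesis by (metis ennreal_1 ennreal_le_iff2 not_one_le_zero)
qed

lemma exp_moments_le_add:
  assumes Y: "exp_moments_le M Y \<kappa>" and Z: "exp_moments_le M Z \<mu>"
    and X: "X \<in> borel_measurable M" "AE \<omega> in M. \<bar>X \<omega>\<bar> \<le> \<bar>Y \<omega>\<bar> + \<bar>Z \<omega>\<bar>"
  shows "exp_moments_le M X (\<lambda>c. \<kappa> (2 * c) + \<mu> (2 * c))"
  unfolding exp_moments_le_def
proof (intro conjI X allI impI)
  fix c :: real assume c: "0 \<le> c"
  note [measurable] = exp_moments_leD(1)[OF Y] exp_moments_leD(1)[OF Z]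
  have "(\<integral>\<^sup>+\<omega>. ennreal (exp (c * \<bar>X \<omega>\<bar>)) \<partial>M)
      \<le> (\<integral>\<^sup>+\<omega>. ennreal (exp (2 * c * \<bar>Y \<omega>\<bar>)) + ennreal (exp (2 * c * \<bar>Z \<omega>\<bar>)) \<partial>M)"
  proof (rule nn_integral_mono_AE, use X(2) in eventually_elim)
    fix \<omega> assume "\<bar>X \<omega>\<bar> \<le> \<bar>Y \<omega>\<bar> + \<bar>Z \<omega>\<bar>"
    then have "exp (c * \<bar>X \<omega>\<bar>) \<le> exp (c * \<bar>Y \<omega>\<bar> + c * \<bar>Z \<omega>\<bar>)"
      using c by (simp flip: distrib_left add: mult_left_mono)
    also have "\<dots> \<le> exp (2 * c * \<bar>Y \<omega>\<bar>) + exp (2 * c * \<bar>Z \<omega>\<bar>)"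
      using exp_add_le by (simp add: mult.assoc)
    finally show "ennreal (exp (c * \<bar>X \<omega>\<bar>))
        \<le> ennreal (exp (2 * c * \<bar>Y \<omega>\<bar>)) + ennreal (exp (2 * c * \<bar>Z \<omega>\<bar>))"
      by (simp flip: ennreal_plus)
  qed
  also have "\<dots> = (\<integral>\<^sup>+\<omega>. ennreal (exp (2 * c * \<bar>Y \<omega>\<bar>)) \<partial>M) + (\<integral>\<^sup>+\<omega>. ennreal (exp (2 * c * \<bar>Z \<omega>\<bar>)) \<partial>M)"
    by (rule nn_integral_add) measurable
  also have "\<dots> \<le> ennreal (\<kappa> (2 * c)) + ennreal (\<mu> (2 * c))"
    using c by (intro add_mono exp_moments_leD(2)[OF Y] exp_moments_leD(2)[OF Z]) auto
  also have "\<dots> = ennreal (\<kappa> (2 * c) + \<mu> (2 * c))"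
    using exp_moments_le_ge_1[OF Y, of "2 * c"] exp_moments_le_ge_1[OF Z, of "2 * c"] c
    by (simp add: ennreal_plus)
  finally show "(\<integral>\<^sup>+\<omega>. ennreal (exp (c * \<bar>X \<omega>\<bar>)) \<partial>M) \<le> ennreal (\<kappa> (2 * c) + \<mu> (2 * c))" .
qed

lemma exp_moments_le_scale:
  assumes Y: "exp_moments_le M Y \<kappa>"
    and X: "X \<in> borel_measurable M" "AE \<omega> in M. \<bar>X \<omega>\<bar> \<le> b * \<bar>Y \<omega>\<bar>" and b: "0 \<le> b"
  shows "exp_moments_le M X (\<lambda>c. \<kappa> (c * b))"
  unfolding exp_moments_le_def
proof (intro conjI X allI impI)
  fix c :: real assume c: "0 \<le> c"
  have "(\<integral>\<^sup>+\<omega>. ennreal (exp (c * \<bar>X \<omega>\<bar>)) \<partial>M) \<le> (\<integral>\<^sup>+\<omega>. ennreal (exp (c * b * \<bar>Y \<omega>\<bar>)) \<partial>M)"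
    by (rule nn_integral_mono_AE, use X(2) in eventually_elim)
      (use c in \<open>auto intro!: ennreal_leI mult_left_mono simp: mult.assoc\<close>)
  also have "\<dots> \<le> ennreal (\<kappa> (c * b))"
    using c b by (intro exp_moments_leD(2)[OF Y]) auto
  finally show "(\<integral>\<^sup>+\<omega>. ennreal (exp (c * \<bar>X \<omega>\<bar>)) \<partial>M) \<le> ennreal (\<kappa> (c * b))" .
qed

lemma exp_moments_le_gaussian:
  assumes [measurable]: "Y \<in> borel_measurable M"
    and mgf: "\<And>c. (\<integral>\<^sup>+\<omega>. ennreal (exp (c * Y \<omega>)) \<partial>M) \<le> ennreal (exp (\<bar>c\<bar> * K + c\<^sup>2 / 2))"
  shows "exp_moments_le M Y (gaussian_moments K)"
  unfolding exp_moments_le_def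
proof (intro conjI assms allI impI)
  fix c :: real assume c: "0 \<le> c"
  have "exp (c * \<bar>y\<bar>) \<le> exp (c * y) + exp (- c * y)" for y
    by (cases "0 \<le> y") (auto simp: add_increasing add_increasing2)
  then have "(\<integral>\<^sup>+\<omega>. ennreal (exp (c * \<bar>Y \<omega>\<bar>)) \<partial>M)
      \<le> (\<integral>\<^sup>+\<omega>. ennreal (exp (c * Y \<omega>)) + ennreal (exp (- c * Y \<omega>)) \<partial>M)"
    by (intro nn_integral_mono) (simp flip: ennreal_plus)
  also have "\<dots> = (\<integral>\<^sup>+\<omega>. ennreal (exp (c * Y \<omega>)) \<partial>M) + (\<integral>\<^sup>+\<omega>. ennreal (exp (- c * Y \<omega>)) \<partial>M)"
    by (rule nn_integral_add) measurable
  also have "\<dots> \<le> ennreal (exp (c * K + c\<^sup>2 / 2)) + ennreal (exp (c * K + c\<^sup>2 / 2))"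
    using mgf[of c] mgf[of "- c"] c by (intro add_mono) auto
  also have "\<dots> = ennreal (gaussian_moments K c)"
    by (simp add: gaussian_moments_def flip: ennreal_plus)
  finally show "(\<integral>\<^sup>+\<omega>. ennreal (exp (c * \<bar>Y \<omega>\<bar>)) \<partial>M) \<le> ennreal (gaussian_moments K c)" .
qed

end

text \<open>Completing the square turns the integrand into a constant times the normal density with
  mean \<open>c * s\<^sup>2\<close>.\<close>

lemma nn_integral_normal_mgf:
  assumes "0 < s"
  shows "(\<integral>\<^sup>+x. ennreal (normal_density 0 s x) * ennreal (exp (c * x)) \<partial>lborel) = ennreal (exp (c\<^sup>2 * s\<^sup>2 / 2))"
proof -
  have "normal_density 0 s x * exp (c * x) = exp (c\<^sup>2 * s\<^sup>2 / 2) * normal_density (c * s\<^sup>2) s x" for x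
  proof -
    have "- (x - 0)\<^sup>2 / (2 * s\<^sup>2) + c * x = c\<^sup>2 * s\<^sup>2 / 2 + - (x - c * s\<^sup>2)\<^sup>2 / (2 * s\<^sup>2)"
      using assms by (simp add: field_simps power2_eq_square)
    then show ?thesis unfolding normal_density_def by (simp flip: exp_add add: mult.left_commute)
  qed
  then have "(\<integral>\<^sup>+x. ennreal (normal_density 0 s x) * ennreal (exp (c * x)) \<partial>lborel)
      = (\<integral>\<^sup>+x. ennreal (exp (c\<^sup>2 * s\<^sup>2 / 2)) * ennreal (normal_density (c * s\<^sup>2) s x) \<partial>lborel)"
    by (simp flip: ennreal_mult)
  also have "\<dots> = ennreal (exp (c\<^sup>2 * s\<^sup>2 / 2)) * (\<integral>\<^sup>+x. ennreal (normal_density (c * s\<^sup>2) s x) \<partial>lborel)"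
    by (rule nn_integral_cmult) simp
  also have "(\<integral>\<^sup>+x. ennreal (normal_density (c * s\<^sup>2) s x) \<partial>lborel) = 1"
    using assms by (subst nn_integral_eq_integral) auto
  finally show ?thesis by simp
qed

section \<open>The Wiener process and its increments\<close>

locale wiener =
  fixes M :: "'w measure" and F :: "real \<Rightarrow> 'w measure" and \<beta> :: "real \<Rightarrow> 'w \<Rightarrow> real"
  assumes usual: "usual_conditions M F" and wiener: "wiener_process M F \<beta>"

sublocale wiener \<subseteq> prob_space M
  using usual by (simp add: usual_conditions_def)

context wiener
begin

lemma space_F: "0 \<le> t \<Longrightarrow> space (F t) = space M"
  using usual filtration.space_F[of "space M" "\<lambda>t. F (max 0 t)" t]
  by (simp add: usual_conditions_def max_absorb2)

lemma sets_F_mono: "0 \<le> s \<Longrightarrow> s \<le> t \<Longrightarrow> sets (F s) \<subseteq> sets (F t)"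
  using usual filtration.sets_F_mono[of "space M" "\<lambda>t. F (max 0 t)" s t]
  by (simp add: usual_conditions_def max_absorb2)

lemma subalgebra_F:
  assumes "0 \<le> t"
  shows "subalgebra M (F t)"
proof -
  have "\<forall>t\<ge>0. sets (F t) \<subseteq> sets M"
    using usual unfolding usual_conditions_def by (elim conjE)
  then show ?thesis using assms by (simp add: subalgebra_def space_F)
qed

lemma measurable_F_mono:
  assumes "Y \<in> borel_measurable (F s)" "0 \<le> s" "s \<le> t"
  shows "Y \<in> borel_measurable (F t)"
proof -
  have "subalgebra (F t) (F s)" using assms by (auto simp: subalgebra_def space_F sets_F_mono)
  then show ?thesis using assms(1) measurable_from_subalg by blast
qed

lemma measurable_F: "Y \<in> borel_measurable (F t) \<Longrightarrow> 0 \<le> t \<Longrightarrow> Y \<in> borel_measurable M"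
  using measurable_from_subalg subalgebra_F by blast

lemma wiener_adapted: "0 \<le> t \<Longrightarrow> \<beta> t \<in> borel_measurable (F t)"
  using wiener by (simp add: wiener_process_def)

lemma measurable_wiener: "0 \<le> t \<Longrightarrow> \<beta> t \<in> borel_measurable M"
  using wiener_adapted measurable_F by blast

lemma wiener_increment_mgf:
  assumes "0 \<le> s" "s < t"
  shows "(\<integral>\<^sup>+\<omega>. ennreal (exp (c * (\<beta> t \<omega> - \<beta> s \<omega>))) \<partial>M) = ennreal (exp (c\<^sup>2 * (t - s) / 2))"
proof -
  have "distributed M lborel (\<lambda>\<omega>. \<beta> t \<omega> - \<beta> s \<omega>) (normal_density 0 (sqrt (t - s)))"
    using wiener assms by (simp add: wiener_process_def)
  from distributed_nn_integral[OF this, of "\<lambda>x. ennreal (exp (c * x))"]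
  show ?thesis using nn_integral_normal_mgf[of "sqrt (t - s)" c] assms by simp
qed

text \<open>Independence of the increment from \<open>F s\<close> factorizes the expectation; this
  drives the induction over the steps of the Euler scheme.\<close>

lemma wiener_increment_indep_mgf:
  assumes st: "0 \<le> s" "s < t" and Y: "Y \<in> borel_measurable (F s)"
  shows "(\<integral>\<^sup>+\<omega>. ennreal (exp (Y \<omega> + c * (\<beta> t \<omega> - \<beta> s \<omega>))) \<partial>M)
    = (\<integral>\<^sup>+\<omega>. ennreal (exp (Y \<omega>)) \<partial>M) * ennreal (exp (c\<^sup>2 * (t - s) / 2))"
proof -
  let ?D = "\<lambda>\<omega>. \<beta> t \<omega> - \<beta> s \<omega>"
  note [measurable] = measurable_F[OF Y st(1)] measurable_wiener[of s] measurable_wiener[of t]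
  have D[measurable]: "?D \<in> borel_measurable M" using st by simp
  have ind: "indep_set (sets (F s)) {?D -` B \<inter> space M | B. B \<in> sets borel}"
    using wiener st by (auto simp: wiener_process_def)
  have "indep_var borel Y borel ?D"
    unfolding indep_var_def indep_vars_def2
  proof safe
    fix i show "random_variable (case_bool borel borel i) (case_bool Y ?D i)" by (cases i) auto
  next
    \<comment> \<open>Independence from all of \<open>F s\<close> restricts to the events described
      by \<open>Y\<close>, which belong to it.\<close>
    show "indep_sets (\<lambda>i. {case_bool Y ?D i -` A \<inter> space M |A. A \<in> sets (case_bool borel borel i)}) UNIV"
      using ind[unfolded indep_set_def]
      by (rule indep_sets_mono_sets)
        (use measurable_sets[OF Y] space_F[OF st(1)] in \<open>auto split: bool.split\<close>)
  qed
  then have "indep_var borel ((\<lambda>x. ennreal (exp x)) \<circ> Y) borel ((\<lambda>x. ennreal (exp (c * x))) \<circ> ?D)"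
    by (rule indep_var_compose) measurable
  then have iv: "indep_vars (\<lambda>_. borel) (case_bool (\<lambda>\<omega>. ennreal (exp (Y \<omega>))) (\<lambda>\<omega>. ennreal (exp (c * ?D \<omega>)))) UNIV"
    unfolding indep_var_def by (simp add: o_def case_bool_if if_distrib cong: if_cong)
  have "(\<integral>\<^sup>+\<omega>. ennreal (exp (Y \<omega> + c * ?D \<omega>)) \<partial>M)
      = (\<integral>\<^sup>+\<omega>. (\<Prod>i\<in>UNIV. case_bool (\<lambda>\<omega>. ennreal (exp (Y \<omega>))) (\<lambda>\<omega>. ennreal (exp (c * ?D \<omega>))) i \<omega>) \<partial>M)"
    by (simp add: UNIV_bool exp_add ennreal_mult mult.commute)
  also have "\<dots> = (\<integral>\<^sup>+\<omega>. ennreal (exp (Y \<omega>)) \<partial>M) * (\<integral>\<^sup>+\<omega>. ennreal (exp (c * ?D \<omega>)) \<partial>M)"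
    by (subst indep_vars_nn_integral[OF _ iv]) (auto simp: UNIV_bool mult.commute)
  finally show ?thesis by (simp only: wiener_increment_mgf[OF st])
qed

text \<open>Normalizing by a common \<open>H\<close> instead of \<open>t - s\<close> keeps the
  variance at most 1 and lets increments of different lengths, including length 0, share one
  bound.\<close>

lemma exp_moments_wiener_increment:
  assumes "0 \<le> s" "s \<le> t" "t - s \<le> H" "0 < H"
  shows "exp_moments_le M (\<lambda>\<omega>. (\<beta> t \<omega> - \<beta> s \<omega>) / sqrt H) (gaussian_moments 0)"
proof (rule exp_moments_le_gaussian)
  show "(\<lambda>\<omega>. (\<beta> t \<omega> - \<beta> s \<omega>) / sqrt H) \<in> borel_measurable M"
    using measurable_wiener[of s] measurable_wiener[of t] assms by simp
  fix c :: real
  show "(\<integral>\<^sup>+\<omega>. ennreal (exp (c * ((\<beta> t \<omega> - \<beta> s \<omega>) / sqrt H))) \<partial>M) \<le> ennreal (exp (\<bar>c\<bar> * 0 + c\<^sup>2 / 2))"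
  proof (cases "s = t")
    case True
    then show ?thesis by (simp add: emeasure_space_1)
  next
    case False
    then have st: "s < t" using assms by simp
    have "(\<integral>\<^sup>+\<omega>. ennreal (exp (c * ((\<beta> t \<omega> - \<beta> s \<omega>) / sqrt H))) \<partial>M)
        = ennreal (exp ((c / sqrt H)\<^sup>2 * (t - s) / 2))"
      by (subst wiener_increment_mgf[OF assms(1) st, symmetric]) simp
    also have "\<dots> \<le> ennreal (exp (c\<^sup>2 / 2))"
    proof -
      have "(c / sqrt H)\<^sup>2 * (t - s) = c\<^sup>2 * ((t - s) / H)"
        using assms(4) by (simp add: power_divide)
      also have "\<dots> \<le> c\<^sup>2 * 1" using assms by (intro mult_left_mono) auto
      finally show ?thesis by (auto intro!: ennreal_leI)
    qed
    finally show ?thesis by simp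
  qed
qed

end

section \<open>Averages over time intervals\<close>

lemma riemann_sum_error:
  fixes f :: "real \<Rightarrow> real"
  assumes f: "continuous_on {a..b} f" and h: "0 \<le> h" and n: "a + real n * h \<le> b"
    and e: "\<And>s t. s \<in> {a..b} \<Longrightarrow> t \<in> {a..b} \<Longrightarrow> \<bar>s - t\<bar> \<le> h \<Longrightarrow> \<bar>f s - f t\<bar> \<le> e"
  shows "\<bar>integral {a..a + real n * h} f - h * (\<Sum>j<n. f (a + real (Suc j) * h))\<bar> \<le> real n * h * e"
  using n
proof (induction n)
  case (Suc n)
  let ?s = "a + real n * h" and ?t = "a + real (Suc n) * h"
  have st: "a \<le> ?s" "?s \<le> ?t" "?t \<le> b" "?t - ?s = h" "?s \<le> b" using h Suc.prems by (auto simp: algebra_simps)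
  have int: "f integrable_on {u..v}" if "a \<le> u" "v \<le> b" for u v
    by (rule integrable_continuous_real, rule continuous_on_subset[OF f]) (use that in auto)
  have "\<bar>integral {?s..?t} (\<lambda>s. f s - f ?t)\<bar> \<le> e * (?t - ?s)"
    unfolding real_norm_def[symmetric]
  proof (rule integral_bound[OF st(2)])
    show "continuous_on {?s..?t} (\<lambda>s. f s - f ?t)"
      by (intro continuous_intros continuous_on_subset[OF f]) (use st in auto)
    show "norm (f s - f ?t) \<le> e" if "s \<in> {?s..?t}" for s
    proof -
      have "s \<in> {a..b}" "?t \<in> {a..b}"
        using that st by (auto simp only: atLeastAtMost_iff)
      moreover have "\<bar>s - ?t\<bar> \<le> h" using that st(4) by (simp only: atLeastAtMost_iff) linarith
      ultimately show ?thesis using e by simp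
    qed
  qed
  also have "integral {?s..?t} (\<lambda>s. f s - f ?t) = integral {?s..?t} f - h * f ?t"
    using st int by (subst Henstock_Kurzweil_Integration.integral_diff) auto
  finally have "\<bar>integral {?s..?t} f - h * f ?t\<bar> \<le> e * h" using st(4) by simp
  moreover have "integral {a..?t} f = integral {a..?s} f + integral {?s..?t} f"
    using Henstock_Kurzweil_Integration.integral_combine[OF st(1,2) int] st by simp
  moreover have "\<bar>integral {a..?s} f - h * (\<Sum>j<n. f (a + real (Suc j) * h))\<bar> \<le> real n * h * e"
    using Suc.IH st by simp
  moreover have "real (Suc n) * h * e = real n * h * e + e * h"
    by (simp add: algebra_simps)
  moreover have "h * (\<Sum>j<Suc n. f (a + real (Suc j) * h)) 
      = h * (\<Sum>j<n. f (a + real (Suc j) * h)) + h * f ?t"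
    by (simp add: algebra_simps)
  ultimately show ?case by linarith
qed simp

lemma eventually_uniform_mesh:
  fixes f :: "real \<Rightarrow> real"
  assumes f: "continuous_on {a..b} f" and e: "0 < e"
  shows "\<forall>\<^sub>F N in sequentially. \<forall>s\<in>{a..b}. \<forall>t\<in>{a..b}. \<bar>s - t\<bar> \<le> (b - a) / real N \<longrightarrow> \<bar>f s - f t\<bar> \<le> e"
proof -
  have "uniformly_continuous_on {a..b} f"
    by (rule compact_uniformly_continuous[OF f]) simp
  then obtain d where d: "0 < d" "\<And>s t. s \<in> {a..b} \<Longrightarrow> t \<in> {a..b} \<Longrightarrow> dist t s < d \<Longrightarrow> dist (f t) (f s) < e"
    unfolding uniformly_continuous_on_def using e by metis
  have "(\<lambda>N. (b - a) / real N) \<longlonglongrightarrow> 0" by (rule lim_const_over_n)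
  then have "\<forall>\<^sub>F N in sequentially. (b - a) / real N < d" using d(1) by (rule order_tendstoD)
  then show ?thesis
  proof eventually_elim
    case (elim N)
    show ?case
    proof (intro ballI impI)
      fix s t assume st: "s \<in> {a..b}" "t \<in> {a..b}" "\<bar>s - t\<bar> \<le> (b - a) / real N"
      then have "dist s t < d" using elim by (simp add: dist_real_def)
      from d(2)[OF st(2,1) this] show "\<bar>f s - f t\<bar> \<le> e" by (simp add: dist_real_def)
    qed
  qed
qed

text \<open>Stated for time averages: the approximations are then means with equal weights, to which
  convexity applies.\<close>

lemma riemann_sum_tendsto:
  fixes f :: "real \<Rightarrow> real"
  assumes ab: "a < b" and f: "continuous_on {a..b} f"
  shows "(\<lambda>N. (\<Sum>j<N. f (a + real (Suc j) * ((b - a) / real N))) / real N) \<longlonglongrightarrow> integral {a..b} f / (b - a)"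
proof (rule LIMSEQ_I)
  fix e :: real assume e: "0 < e"
  have "\<forall>\<^sub>F N in sequentially.
      norm ((\<Sum>j<N. f (a + real (Suc j) * ((b - a) / real N))) / real N - integral {a..b} f / (b - a)) < e"
    using eventually_uniform_mesh[OF f half_gt_zero[OF e]] eventually_gt_at_top[of "0::nat"]
  proof eventually_elim
    case (elim N)
    let ?h = "(b - a) / real N" and ?S = "\<Sum>j<N. f (a + real (Suc j) * ((b - a) / real N))"
    have "\<bar>integral {a..a + real N * ?h} f - ?h * ?S\<bar> \<le> real N * ?h * (e / 2)"
      by (rule riemann_sum_error[OF f]) (use ab elim in auto)
    then have "\<bar>integral {a..b} f - ?h * ?S\<bar> \<le> (b - a) * (e / 2)" using elim by simp
    then have "\<bar>integral {a..b} f - ?h * ?S\<bar> / (b - a) \<le> e / 2" using ab by (simp add: field_simps)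
    also have "\<bar>integral {a..b} f - ?h * ?S\<bar> / (b - a) = \<bar>(integral {a..b} f - ?h * ?S) / (b - a)\<bar>"
      using ab by simp
    also have "(integral {a..b} f - ?h * ?S) / (b - a) = integral {a..b} f / (b - a) - ?S / real N"
      using ab elim by (simp add: field_simps)
    finally show ?case using e by (simp add: abs_minus_commute)
  qed
  then show "\<exists>N0. \<forall>N\<ge>N0.
      norm ((\<Sum>j<N. f (a + real (Suc j) * ((b - a) / real N))) / real N - integral {a..b} f / (b - a)) < e"
    by (simp add: eventually_sequentially)
qed

section \<open>Exponential moments under limits, convex combinations and time averages\<close>

context prob_space
begin

text \<open>Fatou's lemma passes the bound to the limit with the same
  \<open>\<kappa>\<close>.\<close>

lemma exp_moments_le_limit:
  assumes Y: "\<And>n. exp_moments_le M (Y n) \<kappa>" and X: "X \<in> borel_measurable M"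
    and lim: "AE \<omega> in M. (\<lambda>n. Y n \<omega>) \<longlonglongrightarrow> X \<omega>"
  shows "exp_moments_le M X \<kappa>"
  unfolding exp_moments_le_def
proof (intro conjI X allI impI)
  fix c :: real assume c: "0 \<le> c"
  note [measurable] = exp_moments_leD(1)[OF Y]
  have "(\<integral>\<^sup>+\<omega>. ennreal (exp (c * \<bar>X \<omega>\<bar>)) \<partial>M) = (\<integral>\<^sup>+\<omega>. liminf (\<lambda>n. ennreal (exp (c * \<bar>Y n \<omega>\<bar>))) \<partial>M)"
  proof (rule nn_integral_cong_AE, use lim in eventually_elim)
    fix \<omega> assume "(\<lambda>n. Y n \<omega>) \<longlonglongrightarrow> X \<omega>"
    then have "(\<lambda>n. ennreal (exp (c * \<bar>Y n \<omega>\<bar>))) \<longlonglongrightarrow> ennreal (exp (c * \<bar>X \<omega>\<bar>))"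
      by (intro tendsto_intros)
    then show "ennreal (exp (c * \<bar>X \<omega>\<bar>)) = liminf (\<lambda>n. ennreal (exp (c * \<bar>Y n \<omega>\<bar>)))"
      by (rule lim_imp_Liminf[OF trivial_limit_sequentially, symmetric])
  qed
  also have "\<dots> \<le> liminf (\<lambda>n. \<integral>\<^sup>+\<omega>. ennreal (exp (c * \<bar>Y n \<omega>\<bar>)) \<partial>M)"
    by (rule nn_integral_liminf) measurable
  also have "\<dots> \<le> ennreal (\<kappa> c)"
    using exp_moments_leD(2)[OF Y c] by (intro Liminf_le) (auto intro: always_eventually)
  finally show "(\<integral>\<^sup>+\<omega>. ennreal (exp (c * \<bar>X \<omega>\<bar>)) \<partial>M) \<le> ennreal (\<kappa> c)" .
qed

text \<open>Jensen's inequality for \<open>exp\<close>. Unlike in \<open>exp_moments_le_add\<close>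
  the bound does not deteriorate, so the lemma can be iterated over any number of time
  steps.\<close>

lemma exp_moments_le_convex_combination:
  assumes I: "finite I" and w: "\<And>i. i \<in> I \<Longrightarrow> 0 \<le> w i" "(\<Sum>i\<in>I. w i) = 1"
    and Y: "\<And>i. i \<in> I \<Longrightarrow> exp_moments_le M (Y i) \<kappa>" and X: "X \<in> borel_measurable M"
    and le: "AE \<omega> in M. \<bar>X \<omega>\<bar> \<le> (\<Sum>i\<in>I. w i * \<bar>Y i \<omega>\<bar>)"
  shows "exp_moments_le M X \<kappa>"
  unfolding exp_moments_le_def
proof (intro conjI X allI impI)
  fix c :: real assume c: "0 \<le> c"
  note [measurable] = exp_moments_leD(1)[OF Y]
  \<comment> \<open>Weights summing to 1 force a nonempty index set, which gives the nonnegativity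
    of \<open>\<kappa> c\<close>.\<close>
  obtain i where "i \<in> I" using w(2) by fastforce
  then have \<kappa>: "0 \<le> \<kappa> c" using exp_moments_le_ge_1[OF Y c] by force
  have "(\<integral>\<^sup>+\<omega>. ennreal (exp (c * \<bar>X \<omega>\<bar>)) \<partial>M) \<le> (\<integral>\<^sup>+\<omega>. (\<Sum>i\<in>I. ennreal (w i) * ennreal (exp (c * \<bar>Y i \<omega>\<bar>))) \<partial>M)"
  proof (rule nn_integral_mono_AE, use le in eventually_elim)
    fix \<omega> assume "\<bar>X \<omega>\<bar> \<le> (\<Sum>i\<in>I. w i * \<bar>Y i \<omega>\<bar>)"
    then have "exp (c * \<bar>X \<omega>\<bar>) \<le> exp (c * (\<Sum>i\<in>I. w i * \<bar>Y i \<omega>\<bar>))"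
      using c by (simp add: mult_left_mono)
    also have "\<dots> = exp (\<Sum>i\<in>I. w i *\<^sub>R (c * \<bar>Y i \<omega>\<bar>))"
      by (simp add: sum_distrib_left mult.left_commute)
    also have "\<dots> \<le> (\<Sum>i\<in>I. w i * exp (c * \<bar>Y i \<omega>\<bar>))"
      by (rule convex_on_sum[OF I _ exp_convex]) (use w \<open>i \<in> I\<close> in auto)
    finally have "ennreal (exp (c * \<bar>X \<omega>\<bar>)) \<le> ennreal (\<Sum>i\<in>I. w i * exp (c * \<bar>Y i \<omega>\<bar>))"
      by (rule ennreal_leI)
    also have "\<dots> = (\<Sum>i\<in>I. ennreal (w i) * ennreal (exp (c * \<bar>Y i \<omega>\<bar>)))"
      using w(1) by (subst sum_ennreal[symmetric]) (auto simp: ennreal_mult)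
    finally show "ennreal (exp (c * \<bar>X \<omega>\<bar>)) \<le> (\<Sum>i\<in>I. ennreal (w i) * ennreal (exp (c * \<bar>Y i \<omega>\<bar>)))" .
  qed
  also have "\<dots> = (\<Sum>i\<in>I. ennreal (w i) * (\<integral>\<^sup>+\<omega>. ennreal (exp (c * \<bar>Y i \<omega>\<bar>)) \<partial>M))"
    by (subst nn_integral_sum) (auto intro!: sum.cong nn_integral_cmult)
  also have "\<dots> \<le> (\<Sum>i\<in>I. ennreal (w i) * ennreal (\<kappa> c))"
    by (intro sum_mono mult_left_mono exp_moments_leD(2)[OF Y c]) auto
  also have "\<dots> = ennreal ((\<Sum>i\<in>I. w i) * \<kappa> c)"
    using w(1) \<kappa> by (simp add: sum_distrib_right flip: ennreal_mult)
  also have "\<dots> = ennreal (\<kappa> c)" using w(2) by simp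
  finally show "(\<integral>\<^sup>+\<omega>. ennreal (exp (c * \<bar>X \<omega>\<bar>)) \<partial>M) \<le> ennreal (\<kappa> c)" .
qed

text \<open>Riemann sums are convex combinations with equal weights, so the bound holds for every
  mesh and survives in the limit. Only finitely many times occur at once, which keeps joint
  measurability in time and \<open>\<omega>\<close> out of the argument.\<close>

lemma exp_moments_le_integral_average:
  assumes ab: "a < b" and f: "\<And>s. s \<in> {a..b} \<Longrightarrow> exp_moments_le M (f s) \<kappa>"
    and cont: "AE \<omega> in M. continuous_on {a..b} (\<lambda>s. f s \<omega>)"
    and X: "X \<in> borel_measurable M" "AE \<omega> in M. X \<omega> = integral {a..b} (\<lambda>s. f s \<omega>) / (b - a)"
  shows "exp_moments_le M X \<kappa>"
proof (rule exp_moments_le_limit[OF _ X(1)])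
  define s where "s n j = a + real (Suc j) * ((b - a) / real (Suc n))" for n j
  have s: "s n j \<in> {a..b}" if "j < Suc n" for n j
  proof -
    have "real (Suc j) * ((b - a) / real (Suc n)) \<le> real (Suc n) * ((b - a) / real (Suc n))"
      using that ab by (intro mult_right_mono) auto
    then show ?thesis using ab by (simp add: s_def)
  qed
  show "exp_moments_le M (\<lambda>\<omega>. (\<Sum>j<Suc n. f (s n j) \<omega>) / real (Suc n)) \<kappa>" for n
  proof (rule exp_moments_le_convex_combination[of "{..<Suc n}" "\<lambda>_. 1 / real (Suc n)" "\<lambda>j. f (s n j)"])
    show "(\<lambda>\<omega>. (\<Sum>j<Suc n. f (s n j) \<omega>) / real (Suc n)) \<in> borel_measurable M"
      by (intro borel_measurable_divide borel_measurable_sum exp_moments_leD(1)[OF f] s) auto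
    show "AE \<omega> in M. \<bar>(\<Sum>j<Suc n. f (s n j) \<omega>) / real (Suc n)\<bar>
        \<le> (\<Sum>j<Suc n. 1 / real (Suc n) * \<bar>f (s n j) \<omega>\<bar>)"
    proof (rule AE_I2)
      fix \<omega>
      have "\<bar>\<Sum>j<Suc n. f (s n j) \<omega>\<bar> / real (Suc n) \<le> (\<Sum>j<Suc n. \<bar>f (s n j) \<omega>\<bar>) / real (Suc n)"
        by (intro divide_right_mono sum_abs) simp
      also have "\<dots> = (\<Sum>j<Suc n. 1 / real (Suc n) * \<bar>f (s n j) \<omega>\<bar>)"
        by (simp only: sum_divide_distrib) simp
      finally show "\<bar>(\<Sum>j<Suc n. f (s n j) \<omega>) / real (Suc n)\<bar>
          \<le> (\<Sum>j<Suc n. 1 / real (Suc n) * \<bar>f (s n j) \<omega>\<bar>)"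
        by (simp only: abs_divide abs_of_nat)
    qed
  qed (use f s in auto)
  show "AE \<omega> in M. (\<lambda>n. (\<Sum>j<Suc n. f (s n j) \<omega>) / real (Suc n)) \<longlonglongrightarrow> X \<omega>"
    using cont X(2)
  proof eventually_elim
    fix \<omega> assume c: "continuous_on {a..b} (\<lambda>s. f s \<omega>)" and X: "X \<omega> = integral {a..b} (\<lambda>s. f s \<omega>) / (b - a)"
    from LIMSEQ_Suc[OF riemann_sum_tendsto[OF ab c]]
    show "(\<lambda>n. (\<Sum>j<Suc n. f (s n j) \<omega>) / real (Suc n)) \<longlonglongrightarrow> X \<omega>"
      unfolding s_def X .
  qed
qed

end

section \<open>The Ornstein--Uhlenbeck process and the implicit Euler scheme\<close>

text \<open>The implicit step solved for its new value, as a function of a single driving path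
  \<open>b\<close>; this separates pathwise estimates from probability.\<close>

primrec implicit_euler :: "real \<Rightarrow> real \<Rightarrow> real \<Rightarrow> (real \<Rightarrow> real) \<Rightarrow> nat \<Rightarrow> real" where
  "implicit_euler \<epsilon> h m0 b 0 = m0"
| "implicit_euler \<epsilon> h m0 b (Suc n) =
     (implicit_euler \<epsilon> h m0 b n + (b (real (Suc n) * h) - b (real n * h)) / \<epsilon>) / (1 + h / \<epsilon>\<^sup>2)"

definition ou_path :: "real \<Rightarrow> real \<Rightarrow> (real \<Rightarrow> real) \<Rightarrow> (real \<Rightarrow> real) \<Rightarrow> bool" where
  "ou_path \<epsilon> m0 b m \<longleftrightarrow> continuous_on {0..} m \<and>
     (\<forall>t\<ge>0. m t = m0 - integral {0..t} (\<lambda>s. m s / \<epsilon>\<^sup>2) + (b t - b 0) / \<epsilon>)"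

lemma ou_path_initial: "ou_path \<epsilon> m0 b m \<Longrightarrow> m 0 = m0"
  by (simp add: ou_path_def)

text \<open>Besides giving the random time of the exact solution, the formula expresses time
  averages of \<open>m\<close> through values at the two endpoints, which makes their measurability
  evident.\<close>

lemma ou_path_integral:
  assumes m: "ou_path \<epsilon> m0 b m" and \<epsilon>: "0 < \<epsilon>" and st: "0 \<le> s" "s \<le> t"
  shows "integral {s..t} m = \<epsilon>\<^sup>2 * (m s - m t) + \<epsilon> * (b t - b s)"
proof -
  have cont: "continuous_on {0..} m" using m by (simp add: ou_path_def)
  have int: "m integrable_on {0..t}"
    by (rule integrable_continuous_real, rule continuous_on_subset[OF cont]) auto
  have "m r = m0 - integral {0..r} m / \<epsilon>\<^sup>2 + (b r - b 0) / \<epsilon>" if "0 \<le> r" for r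
    using m that by (simp add: ou_path_def)
  from this[of s] this[of t] st
  have "m s - m t = (integral {0..t} m - integral {0..s} m) / \<epsilon>\<^sup>2 - (b t - b s) / \<epsilon>"
    by (simp add: diff_divide_distrib)
  also have "integral {0..t} m - integral {0..s} m = integral {s..t} m"
    using Henstock_Kurzweil_Integration.integral_combine[OF st int] by simp
  finally show ?thesis using \<epsilon> by (simp add: field_simps power2_eq_square)
qed

text \<open>Inserting \<open>ou_path_integral\<close> cancels the noise increment. The new error is
  a convex combination of the old one and of the difference between the endpoint value of
  \<open>m\<close> and its mean over the step, whatever the size of \<open>\<tau>\<close>.\<close>

lemma implicit_euler_error_step:
  assumes m: "ou_path \<epsilon> m0 b m" and \<epsilon>: "0 < \<epsilon>" and h: "0 < h"
  defines "\<tau> \<equiv> h / \<epsilon>\<^sup>2" and "x \<equiv> implicit_euler \<epsilon> h m0 b"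
  defines "s \<equiv> \<lambda>n. real n * h"
  shows "m (s (Suc n)) - x (Suc n) = 1 / (1 + \<tau>) * (m (s n) - x n)
    + \<tau> / (1 + \<tau>) * (m (s (Suc n)) - integral {s n..s (Suc n)} m / h)"
proof -
  have \<tau>: "0 < \<tau>" "1 + \<tau> \<noteq> 0" unfolding \<tau>_def using \<epsilon> h by (auto simp: add_pos_pos less_imp_neq[THEN not_sym])
  have "integral {s n..s (Suc n)} m
      = \<epsilon>\<^sup>2 * (m (s n) - m (s (Suc n))) + \<epsilon> * (b (s (Suc n)) - b (s n))"
    by (rule ou_path_integral[OF m \<epsilon>]) (use h in \<open>auto simp: s_def algebra_simps\<close>)
  then have "\<tau> * (integral {s n..s (Suc n)} m / h)
      = m (s n) - m (s (Suc n)) + (b (s (Suc n)) - b (s n)) / \<epsilon>"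
    unfolding \<tau>_def using \<epsilon> h by (simp add: field_simps power2_eq_square)
  moreover have "x (Suc n) = (x n + (b (s (Suc n)) - b (s n)) / \<epsilon>) / (1 + \<tau>)"
    by (simp add: x_def s_def \<tau>_def)
  moreover have "m' - (x' + d) / (1 + \<tau>)
      = 1 / (1 + \<tau>) * (m'' - x') + \<tau> / (1 + \<tau>) * (m' - I)"
    if "\<tau> * I = m'' - m' + d" for m' x' d m'' I :: real
  proof -
    have "\<tau> / (1 + \<tau>) * (m' - I) = (\<tau> * m' - \<tau> * I) / (1 + \<tau>)" by (simp add: algebra_simps)
    also have "\<dots> = (\<tau> * m' - (m'' - m' + d)) / (1 + \<tau>)" by (simp only: that)
    finally have "1 / (1 + \<tau>) * (m'' - x') + \<tau> / (1 + \<tau>) * (m' - I)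
        = ((m'' - x') + (\<tau> * m' - (m'' - m' + d))) / (1 + \<tau>)"
      by (simp only: add_divide_distrib) simp
    also have "\<dots> = ((1 + \<tau>) * m' - (x' + d)) / (1 + \<tau>)" by (simp add: algebra_simps)
    also have "\<dots> = m' - (x' + d) / (1 + \<tau>)" using \<tau>(2) by (simp add: diff_divide_distrib)
    finally show ?thesis by simp
  qed
  ultimately show ?thesis by simp
qed

text \<open>Both terms of the convex combination in \<open>implicit_euler_error_step\<close> are at
  most the oscillation \<open>e\<close> over one step, so errors do not accumulate.\<close>

lemma implicit_euler_error_le_oscillation:
  assumes m: "ou_path \<epsilon> m0 b m" and \<epsilon>: "0 < \<epsilon>" and h: "0 < h" and n: "real n * h \<le> T"
    and e: "\<And>s t. s \<in> {0..T} \<Longrightarrow> t \<in> {0..T} \<Longrightarrow> \<bar>s - t\<bar> \<le> h \<Longrightarrow> \<bar>m s - m t\<bar> \<le> e"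
  shows "\<bar>m (real n * h) - implicit_euler \<epsilon> h m0 b n\<bar> \<le> e"
  using n
proof (induction n)
  case 0
  have "0 \<le> e" using e[of 0 0] 0 h by simp
  then show ?case using ou_path_initial[OF m] by simp
next
  case (Suc n)
  define s where "s n = real n * h" for n
  define \<tau> where "\<tau> = h / \<epsilon>\<^sup>2"
  let ?x = "implicit_euler \<epsilon> h m0 b"
  let ?r = "m (s (Suc n)) - integral {s n..s (Suc n)} m / h"
  have \<tau>: "0 < \<tau>" using \<epsilon> h by (simp add: \<tau>_def)
  have st: "0 \<le> s n" "s n \<le> s (Suc n)" "s (Suc n) \<le> T" "s (Suc n) - s n = h"
    using h Suc.prems by (auto simp: s_def algebra_simps)
  have cont: "continuous_on {s n..s (Suc n)} m"
    using m st(1) by (auto simp: ou_path_def intro: continuous_on_subset)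
  have "norm (integral {s n..s (Suc n)} (\<lambda>t. m (s (Suc n)) - m t)) \<le> e * (s (Suc n) - s n)"
  proof (rule integral_bound[OF st(2)])
    show "continuous_on {s n..s (Suc n)} (\<lambda>t. m (s (Suc n)) - m t)"
      by (intro continuous_intros cont)
    show "norm (m (s (Suc n)) - m t) \<le> e" if "t \<in> {s n..s (Suc n)}" for t
    proof -
      have "t \<in> {0..T}" "s (Suc n) \<in> {0..T}" using that st by simp_all
      moreover have "\<bar>s (Suc n) - t\<bar> \<le> h" using that st(4) by (simp only: atLeastAtMost_iff) linarith
      ultimately show ?thesis using e by simp
    qed
  qed
  also have "integral {s n..s (Suc n)} (\<lambda>t. m (s (Suc n)) - m t) = h * m (s (Suc n)) - integral {s n..s (Suc n)} m"
    using st by (subst Henstock_Kurzweil_Integration.integral_diff) (auto intro: integrable_continuous_real cont)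
  also have "\<dots> = h * ?r" using h by (simp add: field_simps)
  finally have r: "\<bar>?r\<bar> \<le> e" using h st(4) by (simp add: abs_mult mult.commute)
  have "m (s (Suc n)) - ?x (Suc n) = 1 / (1 + \<tau>) * (m (s n) - ?x n) + \<tau> / (1 + \<tau>) * ?r"
    unfolding \<tau>_def s_def by (rule implicit_euler_error_step[OF m \<epsilon> h])
  also have "\<bar>\<dots>\<bar> \<le> 1 / (1 + \<tau>) * \<bar>m (s n) - ?x n\<bar> + \<tau> / (1 + \<tau>) * \<bar>?r\<bar>"
    using \<tau> by (intro order_trans[OF abs_triangle_ineq]) (simp add: abs_mult)
  also have "\<dots> \<le> 1 / (1 + \<tau>) * e + \<tau> / (1 + \<tau>) * e"
    using \<tau> r Suc.IH st by (intro add_mono mult_left_mono) (auto simp: s_def)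
  also have "\<dots> = (1 / (1 + \<tau>) + \<tau> / (1 + \<tau>)) * e" by (simp only: distrib_right)
  also have "1 / (1 + \<tau>) + \<tau> / (1 + \<tau>) = 1" using \<tau> by (simp add: field_simps)
  finally show ?case unfolding s_def[symmetric] by simp
qed

text \<open>Convergence for fixed \<open>\<epsilon>\<close>, without a rate, by uniform continuity
  of the path. It serves to carry the moment bounds of the Euler scheme over to the exact
  process.\<close>

lemma implicit_euler_tendsto:
  assumes m: "ou_path \<epsilon> m0 b m" and \<epsilon>: "0 < \<epsilon>" and t: "0 < t"
  shows "(\<lambda>N. implicit_euler \<epsilon> (t / real N) m0 b N) \<longlonglongrightarrow> m t"
proof (rule LIMSEQ_I)
  fix e :: real assume e: "0 < e"
  have cont: "continuous_on {0..t} m"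
    using m by (auto simp: ou_path_def intro: continuous_on_subset)
  have "\<forall>\<^sub>F N in sequentially. norm (implicit_euler \<epsilon> (t / real N) m0 b N - m t) < e"
    using eventually_uniform_mesh[OF cont half_gt_zero[OF e]] eventually_gt_at_top[of "0::nat"]
  proof eventually_elim
    case (elim N)
    have "\<bar>m (real N * (t / real N)) - implicit_euler \<epsilon> (t / real N) m0 b N\<bar> \<le> e / 2"
      by (rule implicit_euler_error_le_oscillation[OF m \<epsilon>, of _ _ t]) (use elim t in auto)
    then show ?case using e elim by (simp add: abs_minus_commute)
  qed
  then show "\<exists>N0. \<forall>N\<ge>N0. norm (implicit_euler \<epsilon> (t / real N) m0 b N - m t) < e"
    by (simp add: eventually_sequentially)
qed

section \<open>Exponential moments of the implicit Euler scheme\<close>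

context wiener
begin

lemma implicit_euler_adapted:
  assumes "0 < h"
  shows "(\<lambda>\<omega>. implicit_euler \<epsilon> h m0 (\<lambda>t. \<beta> t \<omega>) n) \<in> borel_measurable (F (real n * h))"
proof (induction n)
  case (Suc n)
  have le: "0 \<le> real n * h" "real n * h \<le> real (Suc n) * h" using assms by (auto simp: algebra_simps)
  note [measurable] = measurable_F_mono[OF Suc le] measurable_F_mono[OF wiener_adapted[OF le(1)] le]
    wiener_adapted[OF order_trans[OF le]]
  show ?case unfolding implicit_euler.simps by measurable
qed simp

text \<open>Independence splits off the last increment and damps \<open>c\<close> to
  \<open>a = c / (1 + \<tau>)\<close>, hence the induction over all \<open>c\<close>. The noise adds
  \<open>a\<^sup>2 * \<tau>\<close> to \<open>a\<^sup>2\<close>, and the total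
  \<open>c\<^sup>2 / (1 + \<tau>)\<close> is at most \<open>c\<^sup>2\<close>; so the bound involves
  neither \<open>n\<close> nor \<open>h\<close> nor \<open>\<epsilon>\<close>.\<close>

lemma implicit_euler_mgf:
  assumes \<epsilon>: "0 < \<epsilon>" and h: "0 < h" and K: "\<bar>m0\<bar> \<le> K"
  shows "(\<integral>\<^sup>+\<omega>. ennreal (exp (c * implicit_euler \<epsilon> h m0 (\<lambda>t. \<beta> t \<omega>) n)) \<partial>M)
    \<le> ennreal (exp (\<bar>c\<bar> * K + c\<^sup>2 / 2))"
proof (induction n arbitrary: c)
  case 0
  have "c * m0 \<le> \<bar>c\<bar> * K"
    using mult_mono[OF order_refl[of "\<bar>c\<bar>"] K] abs_ge_self[of "c * m0"] by (simp add: abs_mult)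
  then show ?case by (auto simp: emeasure_space_1 intro!: ennreal_leI add_increasing2)
next
  case (Suc n)
  define \<tau> where "\<tau> = h / \<epsilon>\<^sup>2"
  define a where "a = c / (1 + \<tau>)"
  have \<tau>: "0 < \<tau>" using \<epsilon> h by (simp add: \<tau>_def)
  let ?x = "\<lambda>n \<omega>. implicit_euler \<epsilon> h m0 (\<lambda>t. \<beta> t \<omega>) n"
  let ?s = "real n * h" and ?t = "real (Suc n) * h"
  have st: "0 \<le> ?s" "?s < ?t" "?t - ?s = h" using h by (auto simp: algebra_simps)
  have "c * ?x (Suc n) \<omega> = a * ?x n \<omega> + a / \<epsilon> * (\<beta> ?t \<omega> - \<beta> ?s \<omega>)" for \<omega>
    unfolding implicit_euler.simps \<tau>_def[symmetric] a_def
  proof -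
    have "c * ((x + d / \<epsilon>) / q) = c / q * x + c / q / \<epsilon> * d" for x d q
      by (simp add: add_divide_distrib distrib_left mult_ac)
    then show "c * ((?x n \<omega> + (\<beta> ?t \<omega> - \<beta> ?s \<omega>) / \<epsilon>) / (1 + \<tau>))
        = c / (1 + \<tau>) * ?x n \<omega> + c / (1 + \<tau>) / \<epsilon> * (\<beta> ?t \<omega> - \<beta> ?s \<omega>)" .
  qed
  then have "(\<integral>\<^sup>+\<omega>. ennreal (exp (c * ?x (Suc n) \<omega>)) \<partial>M)
      = (\<integral>\<^sup>+\<omega>. ennreal (exp (a * ?x n \<omega> + a / \<epsilon> * (\<beta> ?t \<omega> - \<beta> ?s \<omega>))) \<partial>M)"
    by simp
  also have "\<dots> = (\<integral>\<^sup>+\<omega>. ennreal (exp (a * ?x n \<omega>)) \<partial>M) * ennreal (exp ((a / \<epsilon>)\<^sup>2 * (?t - ?s) / 2))"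
    by (rule wiener_increment_indep_mgf[OF st(1,2)])
      (intro borel_measurable_times borel_measurable_const implicit_euler_adapted h)
  also have "\<dots> \<le> ennreal (exp (\<bar>a\<bar> * K + a\<^sup>2 / 2)) * ennreal (exp ((a / \<epsilon>)\<^sup>2 * (?t - ?s) / 2))"
    by (intro mult_right_mono Suc.IH) simp
  also have "\<dots> = ennreal (exp (\<bar>a\<bar> * K + a\<^sup>2 * (1 + \<tau>) / 2))"
    unfolding st(3) \<tau>_def by (simp add: power_divide add_divide_distrib distrib_left flip: ennreal_mult exp_add)
  also have "\<dots> \<le> ennreal (exp (\<bar>c\<bar> * K + c\<^sup>2 / 2))"
  proof -
    have "\<bar>a\<bar> \<le> \<bar>c\<bar>" unfolding a_def using \<tau> by (simp add: abs_divide divide_le_eq mult_left_mono add_increasing2 algebra_simps)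
    moreover have "0 \<le> K" using K by simp
    moreover have "a\<^sup>2 * (1 + \<tau>) \<le> c\<^sup>2"
    proof -
      have "a\<^sup>2 * (1 + \<tau>) = c\<^sup>2 / (1 + \<tau>)" using \<tau> by (simp add: a_def power2_eq_square)
      also have "\<dots> \<le> c\<^sup>2 / 1" using \<tau> by (intro divide_left_mono) auto
      finally show ?thesis by simp
    qed
    ultimately show ?thesis by (auto intro!: ennreal_leI add_mono mult_right_mono)
  qed
  finally show ?case .
qed

lemma exp_moments_implicit_euler:
  assumes "0 < \<epsilon>" "0 < h" "\<bar>m0\<bar> \<le> K"
  shows "exp_moments_le M (\<lambda>\<omega>. implicit_euler \<epsilon> h m0 (\<lambda>t. \<beta> t \<omega>) n) (gaussian_moments K)"
proof (rule exp_moments_le_gaussian)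
  show "(\<lambda>\<omega>. implicit_euler \<epsilon> h m0 (\<lambda>t. \<beta> t \<omega>) n) \<in> borel_measurable M"
    using measurable_F[OF implicit_euler_adapted] assms by simp
qed (rule implicit_euler_mgf[OF assms])

end

text \<open>The outcome of two rounds of pairwise addition in
  \<open>exp_moments_ou_increment\<close>, each doubling the exponent: two endpoint values and one
  time average of the process, and one Wiener increment.\<close>

definition increment_moments :: "real \<Rightarrow> real \<Rightarrow> real" where
  "increment_moments K c = 3 * gaussian_moments K (2 * (2 * c)) + gaussian_moments 0 (2 * (2 * c))"

section \<open>Bounds for the Ornstein-Uhlenbeck process and its Euler error, uniform in
  \<open>\<epsilon>\<close>\<close>

locale ou = wiener +
  fixes \<epsilon> m0 K :: real and m
  assumes \<epsilon>: "0 < \<epsilon>" and K: "\<bar>m0\<bar> \<le> K"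
    and measurable_ou: "0 \<le> t \<Longrightarrow> m t \<in> borel_measurable M"
    and path: "AE \<omega> in M. ou_path \<epsilon> m0 (\<lambda>t. \<beta> t \<omega>) (\<lambda>t. m t \<omega>)"
begin

abbreviation euler :: "real \<Rightarrow> nat \<Rightarrow> 'a \<Rightarrow> real" where
  "euler h n \<omega> \<equiv> implicit_euler \<epsilon> h m0 (\<lambda>t. \<beta> t \<omega>) n"

lemma measurable_euler: "0 < h \<Longrightarrow> euler h n \<in> borel_measurable M"
  by (rule measurable_F[OF implicit_euler_adapted]) auto

lemma exp_moments_ou:
  assumes t: "0 \<le> t"
  shows "exp_moments_le M (m t) (gaussian_moments K)"
proof (cases "t = 0")
  case True
  \<comment> \<open>Zero Euler steps, here of arbitrary size 1, reproduce the initial value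
    \<open>m0\<close>.\<close>
  have "exp_moments_le M (m t) (\<lambda>c. gaussian_moments K (c * 1))"
    by (rule exp_moments_le_scale[OF exp_moments_implicit_euler[OF \<epsilon> zero_less_one K, of 0] measurable_ou[OF t]])
      (use path in \<open>auto simp: True dest: ou_path_initial\<close>)
  then show ?thesis by simp
next
  case False
  show ?thesis
  proof (rule exp_moments_le_limit[OF _ measurable_ou[OF t]])
    show "exp_moments_le M (euler (t / real (Suc n)) (Suc n)) (gaussian_moments K)" for n
      by (rule exp_moments_implicit_euler[OF \<epsilon> _ K]) (use t False in auto)
    show "AE \<omega> in M. (\<lambda>n. euler (t / real (Suc n)) (Suc n) \<omega>) \<longlonglongrightarrow> m t \<omega>"
      using path
    proof eventually_elim
      case (elim \<omega>)
      show ?case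
        using LIMSEQ_Suc[OF implicit_euler_tendsto[OF elim \<epsilon>, of t]] t False by simp
    qed
  qed
qed

text \<open>In the regime \<open>\<epsilon> \<le> sqrt H\<close> the factor \<open>\<epsilon>\<close> suffices; otherwise the drift over \<open>[s, t]\<close> is at most
  \<open>H / \<epsilon> \<le> sqrt H\<close> times the time average of the path.\<close>

lemma exp_moments_ou_increment:
  assumes s: "0 \<le> s" and st: "s \<le> t" and H: "t - s \<le> H" "0 < H"
  shows "exp_moments_le M (\<lambda>\<omega>. \<epsilon> * (m t \<omega> - m s \<omega>) / sqrt H) (increment_moments K)"
proof -
  have t: "0 \<le> t" using s st by simp
  note [measurable] = measurable_ou[OF s] measurable_ou[OF t] measurable_wiener[OF s] measurable_wiener[OF t]
  \<comment> \<open>By \<open>ou_path_integral\<close> this is the time average of \<open>m\<close>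
    over \<open>[s, t]\<close>. For \<open>s = t\<close> the division by zero gives the value
    0.\<close>
  define A where "A \<omega> = (\<epsilon>\<^sup>2 * (m s \<omega> - m t \<omega>) + \<epsilon> * (\<beta> t \<omega> - \<beta> s \<omega>)) / (t - s)" for \<omega>
  define W where "W \<omega> = (\<beta> t \<omega> - \<beta> s \<omega>) / sqrt H" for \<omega>
  have [measurable]: "A \<in> borel_measurable M" "W \<in> borel_measurable M"
    unfolding A_def W_def by measurable
  have A: "exp_moments_le M A (gaussian_moments K)"
  proof (cases "s < t")
    case True
    show ?thesis
    proof (rule exp_moments_le_integral_average[OF True, of m])
      show "AE \<omega> in M. continuous_on {s..t} (\<lambda>r. m r \<omega>)"
        using path by eventually_elim (use s in \<open>auto simp: ou_path_def intro: continuous_on_subset\<close>)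
      show "AE \<omega> in M. A \<omega> = integral {s..t} (\<lambda>r. m r \<omega>) / (t - s)"
        using path by eventually_elim (simp add: A_def ou_path_integral[OF _ \<epsilon> s st])
    qed (use s in \<open>auto intro: exp_moments_ou\<close>)
  next
    case False
    have "exp_moments_le M A (\<lambda>c. gaussian_moments K (c * 1))"
      by (rule exp_moments_le_scale[OF exp_moments_ou[OF s]]) (use False st in \<open>auto simp: A_def\<close>)
    then show ?thesis by simp
  qed
  have W: "exp_moments_le M W (gaussian_moments 0)"
    unfolding W_def by (rule exp_moments_wiener_increment[OF s st H])
  \<comment> \<open>The right-hand side adds the terms needed in either regime, so that one bound
    covers both; the nested absolute values match \<open>exp_moments_le_add\<close>.\<close>
  have le: "AE \<omega> in M. \<bar>\<epsilon> * (m t \<omega> - m s \<omega>) / sqrt H\<bar> \<le> \<bar>\<bar>m s \<omega>\<bar> + \<bar>m t \<omega>\<bar>\<bar> + \<bar>\<bar>A \<omega>\<bar> + \<bar>W \<omega>\<bar>\<bar>"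
    using path
  proof eventually_elim
    case (elim \<omega>)
    show ?case
    proof (cases "\<epsilon> \<le> sqrt H")
      case True
      have "\<bar>\<epsilon> * (m t \<omega> - m s \<omega>) / sqrt H\<bar> = \<epsilon> / sqrt H * \<bar>m t \<omega> - m s \<omega>\<bar>"
        using \<epsilon> H by (simp add: abs_mult)
      also have "\<dots> \<le> 1 * \<bar>m t \<omega> - m s \<omega>\<bar>"
        using True H by (intro mult_right_mono) auto
      also have "\<dots> \<le> \<bar>m s \<omega>\<bar> + \<bar>m t \<omega>\<bar>" by simp
      also have "\<dots> \<le> \<bar>\<bar>m s \<omega>\<bar> + \<bar>m t \<omega>\<bar>\<bar> + \<bar>\<bar>A \<omega>\<bar> + \<bar>W \<omega>\<bar>\<bar>" by simp
      finally show ?thesis .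
    next
      case False
      have "\<epsilon> * (m t \<omega> - m s \<omega>) = (\<beta> t \<omega> - \<beta> s \<omega>) - (t - s) / \<epsilon> * A \<omega>"
      proof (cases "s = t")
        case False
        then show ?thesis using \<epsilon> by (simp add: A_def power2_eq_square field_simps)
      qed simp
      moreover have "(d - k * a) / r = d / r - k / r * a" for d k a r :: real
        by (simp add: diff_divide_distrib)
      ultimately have "\<epsilon> * (m t \<omega> - m s \<omega>) / sqrt H = W \<omega> - (t - s) / (\<epsilon> * sqrt H) * A \<omega>"
        by (simp only: W_def divide_divide_eq_left)
      moreover have "\<bar>(t - s) / (\<epsilon> * sqrt H) * A \<omega>\<bar> \<le> \<bar>A \<omega>\<bar>"
      proof -
        have "t - s \<le> sqrt H * sqrt H" using H by simp
        also have "\<dots> \<le> \<epsilon> * sqrt H" using False H by (intro mult_right_mono) auto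
        finally have "(t - s) / (\<epsilon> * sqrt H) \<le> 1" using \<epsilon> H by simp
        then have "(t - s) / (\<epsilon> * sqrt H) * \<bar>A \<omega>\<bar> \<le> 1 * \<bar>A \<omega>\<bar>" by (intro mult_right_mono) auto
        moreover have "0 \<le> (t - s) / (\<epsilon> * sqrt H)" using st \<epsilon> H by simp
        ultimately show ?thesis by (simp only: abs_mult abs_of_nonneg mult_1)
      qed
      moreover have "x = w - k \<Longrightarrow> \<bar>k\<bar> \<le> a \<Longrightarrow> \<bar>x\<bar> \<le> a + \<bar>w\<bar>" for x w k a :: real by linarith
      ultimately have "\<bar>\<epsilon> * (m t \<omega> - m s \<omega>) / sqrt H\<bar> \<le> \<bar>A \<omega>\<bar> + \<bar>W \<omega>\<bar>" by blast
      also have "\<dots> \<le> \<bar>\<bar>m s \<omega>\<bar> + \<bar>m t \<omega>\<bar>\<bar> + \<bar>\<bar>A \<omega>\<bar> + \<bar>W \<omega>\<bar>\<bar>" by simp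
      finally show ?thesis .
    qed
  qed
  have "exp_moments_le M (\<lambda>\<omega>. \<bar>m s \<omega>\<bar> + \<bar>m t \<omega>\<bar>) (\<lambda>c. gaussian_moments K (2 * c) + gaussian_moments K (2 * c))"
    by (rule exp_moments_le_add[OF exp_moments_ou[OF s] exp_moments_ou[OF t]]) auto
  moreover have "exp_moments_le M (\<lambda>\<omega>. \<bar>A \<omega>\<bar> + \<bar>W \<omega>\<bar>) (\<lambda>c. gaussian_moments K (2 * c) + gaussian_moments 0 (2 * c))"
    by (rule exp_moments_le_add[OF A W]) auto
  ultimately have "exp_moments_le M (\<lambda>\<omega>. \<epsilon> * (m t \<omega> - m s \<omega>) / sqrt H)
    (\<lambda>c. (gaussian_moments K (2 * (2 * c)) + gaussian_moments K (2 * (2 * c)))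
      + (gaussian_moments K (2 * (2 * c)) + gaussian_moments 0 (2 * (2 * c))))"
    by (rule exp_moments_le_add) (use le in auto)
  then show ?thesis by (simp add: increment_moments_def[abs_def] add.assoc)
qed

text \<open>Order \<open>sqrt h\<close> without a discrete Gronwall argument: the weights
  \<open>1 / (1 + \<tau>)\<close> and \<open>\<tau> / (1 + \<tau>)\<close> sum to 1, so the same
  bound is reproduced at every step for any ratio \<open>\<tau>\<close> of \<open>h\<close> to
  \<open>\<epsilon>\<^sup>2\<close>.\<close>

lemma exp_moments_euler_error:
  assumes h: "0 < h"
  shows "exp_moments_le M (\<lambda>\<omega>. \<epsilon> * (m (real n * h) \<omega> - euler h n \<omega>) / sqrt h) (increment_moments K)"
proof (induction n)
  case 0
  \<comment> \<open>The initial error vanishes and is compared with the trivial increment from 0 to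
    0.\<close>
  have "exp_moments_le M (\<lambda>\<omega>. \<epsilon> * (m (real 0 * h) \<omega> - euler h 0 \<omega>) / sqrt h) (\<lambda>c. increment_moments K (c * 1))"
  proof (rule exp_moments_le_scale[OF exp_moments_ou_increment[of 0 0 h]])
    show "AE \<omega> in M. \<bar>\<epsilon> * (m (real 0 * h) \<omega> - euler h 0 \<omega>) / sqrt h\<bar>
        \<le> 1 * \<bar>\<epsilon> * (m 0 \<omega> - m 0 \<omega>) / sqrt h\<bar>"
      using path by eventually_elim (drule ou_path_initial, simp)
  qed (use h measurable_ou[of 0] in auto)
  then show ?case by simp
next
  case (Suc n)
  define s t \<tau> where "s = real n * h" and "t = real (Suc n) * h" and "\<tau> = h / \<epsilon>\<^sup>2"
  have st: "0 \<le> s" "s < t" "t - s = h" "0 \<le> t" using h by (auto simp: s_def t_def algebra_simps)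
  have \<tau>: "0 < \<tau>" using h \<epsilon> by (simp add: \<tau>_def)
  note [measurable] = measurable_ou[OF st(1)] measurable_ou[OF st(4)]
    measurable_wiener[OF st(1)] measurable_wiener[OF st(4)] measurable_euler[OF h]
  \<comment> \<open>The mean of \<open>m\<close> over the step, again in the explicit form of
    \<open>ou_path_integral\<close>.\<close>
  define avg where "avg \<omega> = (\<epsilon>\<^sup>2 * (m s \<omega> - m t \<omega>) + \<epsilon> * (\<beta> t \<omega> - \<beta> s \<omega>)) / h" for \<omega>
  define e where "e \<omega> = \<epsilon> * (m s \<omega> - euler h n \<omega>) / sqrt h" for \<omega>
  \<comment> \<open>\<open>R\<close> is itself a time average, of the rescaled increments from
    \<open>r\<close> to \<open>t\<close> with \<open>r\<close> in \<open>[s, t]\<close>, each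
    bounded by \<open>exp_moments_ou_increment\<close>.\<close>
  define R where "R \<omega> = \<epsilon> * (m t \<omega> - avg \<omega>) / sqrt h" for \<omega>
  have [measurable]: "avg \<in> borel_measurable M" "R \<in> borel_measurable M"
    unfolding R_def avg_def by measurable
  have R: "exp_moments_le M R (increment_moments K)"
  proof (rule exp_moments_le_integral_average[OF st(2), of "\<lambda>r \<omega>. \<epsilon> * (m t \<omega> - m r \<omega>) / sqrt h"])
    show "exp_moments_le M (\<lambda>\<omega>. \<epsilon> * (m t \<omega> - m r \<omega>) / sqrt h) (increment_moments K)" if "r \<in> {s..t}" for r
      by (rule exp_moments_ou_increment) (use that st h in auto)
    show "AE \<omega> in M. continuous_on {s..t} (\<lambda>r. \<epsilon> * (m t \<omega> - m r \<omega>) / sqrt h)"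
      using path by eventually_elim
        (use st h in \<open>auto simp: ou_path_def intro!: continuous_intros intro: continuous_on_subset\<close>)
    show "AE \<omega> in M. R \<omega> = integral {s..t} (\<lambda>r. \<epsilon> * (m t \<omega> - m r \<omega>) / sqrt h) / (t - s)"
      using path
    proof eventually_elim
      case (elim \<omega>)
      have "continuous_on {s..t} (\<lambda>r. m r \<omega>)"
        using elim st by (auto simp: ou_path_def intro: continuous_on_subset)
      then have "integral {s..t} (\<lambda>r. m t \<omega> - m r \<omega>) = h * m t \<omega> - h * avg \<omega>"
        using st h by (subst Henstock_Kurzweil_Integration.integral_diff)
          (auto intro: integrable_continuous_real simp: avg_def ou_path_integral[OF elim \<epsilon> st(1) less_imp_le[OF st(2)]])
      then have "integral {s..t} (\<lambda>r. \<epsilon> * (m t \<omega> - m r \<omega>) / sqrt h) = h * R \<omega>"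
        by (simp add: R_def mult.left_commute flip: right_diff_distrib)
      then show ?case using h st(3) by simp
    qed
  qed measurable
  \<comment> \<open>The two-term convex combination is indexed by \<open>bool\<close>: true stands
    for the old error, false for \<open>R\<close>.\<close>
  have "AE \<omega> in M. \<bar>\<epsilon> * (m t \<omega> - euler h (Suc n) \<omega>) / sqrt h\<bar>
      \<le> (\<Sum>i\<in>UNIV. (if i then 1 / (1 + \<tau>) else \<tau> / (1 + \<tau>)) * \<bar>(if i then e else R) \<omega>\<bar>)"
    using path
  proof eventually_elim
    case (elim \<omega>)
    have "m t \<omega> - euler h (Suc n) \<omega> = 1 / (1 + \<tau>) * (m s \<omega> - euler h n \<omega>) + \<tau> / (1 + \<tau>) * (m t \<omega> - avg \<omega>)"
      using implicit_euler_error_step[OF elim \<epsilon> h, of n]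
      unfolding s_def[symmetric] t_def[symmetric] \<tau>_def[symmetric]
      by (simp only: avg_def ou_path_integral[OF elim \<epsilon> st(1) less_imp_le[OF st(2)]])
    then have "\<epsilon> * (m t \<omega> - euler h (Suc n) \<omega>) / sqrt h = 1 / (1 + \<tau>) * e \<omega> + \<tau> / (1 + \<tau>) * R \<omega>"
      by (simp add: e_def R_def distrib_left add_divide_distrib mult_ac)
    then have "\<bar>\<epsilon> * (m t \<omega> - euler h (Suc n) \<omega>) / sqrt h\<bar> \<le> 1 / (1 + \<tau>) * \<bar>e \<omega>\<bar> + \<tau> / (1 + \<tau>) * \<bar>R \<omega>\<bar>"
      using abs_triangle_ineq[of "1 / (1 + \<tau>) * e \<omega>" "\<tau> / (1 + \<tau>) * R \<omega>"] \<tau> by (simp add: abs_mult)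
    then show ?case by (simp add: UNIV_bool add.commute)
  qed
  then have "exp_moments_le M (\<lambda>\<omega>. \<epsilon> * (m t \<omega> - euler h (Suc n) \<omega>) / sqrt h) (increment_moments K)"
  proof (rule exp_moments_le_convex_combination[rotated -1])
    show "(\<Sum>i\<in>UNIV. if i then 1 / (1 + \<tau>) else \<tau> / (1 + \<tau>)) = 1"
      using \<tau> by (simp add: UNIV_bool field_simps)
    show "exp_moments_le M (if i then e else R) (increment_moments K)" for i
      using Suc R by (simp add: e_def[abs_def] s_def)
    show "(\<lambda>\<omega>. \<epsilon> * (m t \<omega> - euler h (Suc n) \<omega>) / sqrt h) \<in> borel_measurable M"
      by measurable
  qed (use \<tau> in auto)
  then show ?case by (simp only: t_def)
qed

end

section \<open>The strong error of the multiscale scheme\<close>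

text \<open>Collects what controls step \<open>n\<close>: its random time divided by
  \<open>sqrt h\<close>, and the random time remaining after it, whose noise is scaled by the square
  root of the final time. The iterate \<open>x (Suc n)\<close> enters both and is counted twice. The
  grouping in pairs follows \<open>exp_moments_le_add\<close>.\<close>

definition path_size :: "real \<Rightarrow> real \<Rightarrow> real \<Rightarrow> (real \<Rightarrow> real) \<Rightarrow> nat \<Rightarrow> nat \<Rightarrow> real" where
  "path_size \<epsilon> h m0 b N n =
     (let x = implicit_euler \<epsilon> h m0 b in
       ((\<bar>x n\<bar> + \<bar>x (Suc n)\<bar>) + (\<bar>x (Suc n)\<bar> + \<bar>x N\<bar>))
       + (\<bar>(b (real (Suc n) * h) - b (real n * h)) / sqrt h\<bar>
         + \<bar>(b (real N * h) - b (real (Suc n) * h)) / sqrt (real N * h)\<bar>))"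

text \<open>The two forms of the random time of one step: the right one telescopes and is small for
  small \<open>\<epsilon>\<close>, the left one is small for large
  \<open>\<epsilon>\<close>.\<close>

lemma implicit_euler_drift:
  assumes \<epsilon>: "0 < \<epsilon>" and h: "0 < h"
  shows "h * implicit_euler \<epsilon> h m0 b (Suc n) / \<epsilon>
    = \<epsilon> * (implicit_euler \<epsilon> h m0 b n - implicit_euler \<epsilon> h m0 b (Suc n)) + (b (real (Suc n) * h) - b (real n * h))"
proof -
  have "0 < 1 + h / \<epsilon>\<^sup>2" using h by (intro add_pos_nonneg) auto
  then have "implicit_euler \<epsilon> h m0 b (Suc n) * (1 + h / \<epsilon>\<^sup>2)
      = implicit_euler \<epsilon> h m0 b n + (b (real (Suc n) * h) - b (real n * h)) / \<epsilon>" by simp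
  moreover have "h * y / \<epsilon> = \<epsilon> * (x - y) + d" if "y * (1 + h / \<epsilon>\<^sup>2) = x + d / \<epsilon>" for x y d
  proof -
    have "\<epsilon> * (y + h * y / \<epsilon>\<^sup>2) = \<epsilon> * (x + d / \<epsilon>)" using that by (simp add: algebra_simps)
    moreover have "\<epsilon> * (y + h * y / \<epsilon>\<^sup>2) = \<epsilon> * y + h * y / \<epsilon>"
      using \<epsilon> by (simp add: distrib_left power2_eq_square)
    moreover have "\<epsilon> * (x + d / \<epsilon>) = \<epsilon> * x + d" using \<epsilon> by (simp add: distrib_left)
    ultimately show ?thesis by (simp add: algebra_simps)
  qed
  ultimately show ?thesis by blast
qed

lemma implicit_euler_drift_sum:
  assumes \<epsilon>: "0 < \<epsilon>" and h: "0 < h" and "k \<le> n"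
  shows "(\<Sum>j\<in>{k..<n}. h * implicit_euler \<epsilon> h m0 b (Suc j) / \<epsilon>)
    = \<epsilon> * (implicit_euler \<epsilon> h m0 b k - implicit_euler \<epsilon> h m0 b n) + (b (real n * h) - b (real k * h))"
  using \<open>k \<le> n\<close>
proof (induction n rule: dec_induct)
  case (step n)
  then show ?case
    unfolding sum.atLeastLessThan_Suc[OF step.hyps(1)] implicit_euler_drift[OF \<epsilon> h]
    by (simp only: step.IH) (simp add: algebra_simps)
qed simp

text \<open>For \<open>\<epsilon> \<le> sqrt h\<close> the telescoping form is used; otherwise
  \<open>h / \<epsilon> \<le> sqrt h\<close> bounds the left-hand side directly.\<close>

lemma implicit_euler_drift_le:
  assumes \<epsilon>: "0 < \<epsilon>" and h: "0 < h"
  shows "\<bar>h * implicit_euler \<epsilon> h m0 b (Suc n) / \<epsilon>\<bar> \<le> sqrt h *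
    (\<bar>implicit_euler \<epsilon> h m0 b n\<bar> + \<bar>implicit_euler \<epsilon> h m0 b (Suc n)\<bar>
      + \<bar>(b (real (Suc n) * h) - b (real n * h)) / sqrt h\<bar>)"
proof -
  have "\<bar>h * y / \<epsilon>\<bar> \<le> sqrt h * (\<bar>x\<bar> + \<bar>y\<bar> + \<bar>d / sqrt h\<bar>)" if eq: "h * y / \<epsilon> = \<epsilon> * (x - y) + d" for x y d
  proof (cases "\<epsilon> \<le> sqrt h")
    case True
    have "\<bar>h * y / \<epsilon>\<bar> \<le> \<epsilon> * \<bar>x - y\<bar> + \<bar>d\<bar>"
      unfolding eq using \<epsilon> by (intro order_trans[OF abs_triangle_ineq]) (simp add: abs_mult)
    also have "\<dots> \<le> sqrt h * (\<bar>x\<bar> + \<bar>y\<bar>) + \<bar>d\<bar>"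
      using True \<epsilon> h by (intro add_right_mono mult_mono) auto
    also have "\<dots> = sqrt h * (\<bar>x\<bar> + \<bar>y\<bar> + \<bar>d / sqrt h\<bar>)"
      using h by (simp add: distrib_left)
    finally show ?thesis .
  next
    case False
    have "h = sqrt h * sqrt h" using h by simp
    also have "\<dots> \<le> sqrt h * \<epsilon>" using False h by (intro mult_left_mono) auto
    finally have "h / \<epsilon> \<le> sqrt h" using \<epsilon> by (simp add: divide_le_eq)
    then have "\<bar>h * y / \<epsilon>\<bar> \<le> sqrt h * \<bar>y\<bar>"
      using mult_right_mono[of "h / \<epsilon>" "sqrt h" "\<bar>y\<bar>"] \<epsilon> h by (simp add: abs_mult)
    also have "\<dots> \<le> sqrt h * (\<bar>x\<bar> + \<bar>y\<bar> + \<bar>d / sqrt h\<bar>)"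
      using h by (intro mult_left_mono) auto
    finally show ?thesis .
  qed
  from this[OF implicit_euler_drift[OF \<epsilon> h]] show ?thesis .
qed

text \<open>Each local error is of order \<open>h * sqrt h\<close>, and
  \<open>real N * h = T\<close> turns their sum into an average over the steps. In
  \<open>\<rho>\<close>, the 3 absorbs the cube of the step time, \<open>C * sqrt T\<close> the
  exponential in the local error, and \<open>L * (\<epsilon>0 + sqrt T)\<close> the transport over
  the remaining time.\<close>

lemma (in lipschitz_torus_flow) scheme_error_pathwise:
  fixes m b :: "real \<Rightarrow> real" and N :: nat
  assumes \<epsilon>: "0 < \<epsilon>" "\<epsilon> \<le> \<epsilon>0" and T: "0 < T" and N: "1 \<le> N" and h: "h = T / real N" and C: "0 \<le> C"
    and local_error: "\<And>t x. dist (\<Phi> t x) (\<phi> t x) \<le> C * \<bar>t\<bar> ^ 3 * exp (C * \<bar>t\<bar>)"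
    and m: "ou_path \<epsilon> m0 b m"
    and X: "continuous_on {0..} X"
      "\<And>t. 0 \<le> t \<Longrightarrow> X t = x0 + to_torus (integral {0..t} (\<lambda>s. (m s / \<epsilon>) *\<^sub>R \<sigma> (X s)))"
    and Y: "Y 0 = x0" "\<And>n. Y (Suc n) = \<Phi> (h * implicit_euler \<epsilon> h m0 b (Suc n) / \<epsilon>) (Y n)"
  defines "\<rho> \<equiv> 3 + C * sqrt T + L * (\<epsilon>0 + sqrt T)"
  shows "dist (Y N) (X T) / sqrt h
    \<le> C * T * ((\<Sum>n<N. exp (\<rho> * path_size \<epsilon> h m0 b N n)) / real N)
      + B * \<bar>\<epsilon> * (m (real N * h) - implicit_euler \<epsilon> h m0 b N) / sqrt h\<bar>"
proof -
  define x where "x = implicit_euler \<epsilon> h m0 b"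
  define \<delta> where "\<delta> n = h * x (Suc n) / \<epsilon>" for n
  define U where "U = path_size \<epsilon> h m0 b N"
  have hN: "0 < h" "real N * h = T" "h \<le> T" using T N by (auto simp: h field_simps)
  have step_le: "C * \<bar>\<delta> n\<bar> ^ 3 * exp (C * \<bar>\<delta> n\<bar>) * exp (L * \<bar>\<Sum>k\<in>{Suc n..<N}. \<delta> k\<bar>)
      \<le> C * (h * sqrt h) * exp (\<rho> * U n)" if n: "n < N" for n
  proof -
    \<comment> \<open>\<open>V\<close> controls the step time itself; the rest of \<open>U n\<close>
      controls the remaining time.\<close>
    define V where "V = \<bar>x n\<bar> + \<bar>x (Suc n)\<bar> + \<bar>(b (real (Suc n) * h) - b (real n * h)) / sqrt h\<bar>"
    define W where "W = (b (real N * h) - b (real (Suc n) * h)) / sqrt (real N * h)"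
    have U: "U n = V + (\<bar>x (Suc n)\<bar> + \<bar>x N\<bar> + \<bar>W\<bar>)"
      by (simp add: U_def path_size_def V_def W_def x_def Let_def)
    have V: "0 \<le> V" "V \<le> U n" "0 \<le> U n" by (auto simp: U V_def)
    have \<delta>: "\<bar>\<delta> n\<bar> \<le> sqrt h * V"
      unfolding \<delta>_def V_def x_def by (rule implicit_euler_drift_le[OF \<epsilon>(1) hN(1)])
    have S: "\<bar>\<Sum>k\<in>{Suc n..<N}. \<delta> k\<bar> \<le> (\<epsilon>0 + sqrt T) * U n"
    proof -
      have "(\<Sum>k\<in>{Suc n..<N}. \<delta> k) = \<epsilon> * (x (Suc n) - x N) + sqrt T * W"
        unfolding \<delta>_def x_def implicit_euler_drift_sum[OF \<epsilon>(1) hN(1) Suc_leI[OF n]] W_def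
        using T by (simp only: hN(2)) simp
      also have "\<bar>\<dots>\<bar> \<le> \<epsilon> * \<bar>x (Suc n) - x N\<bar> + sqrt T * \<bar>W\<bar>"
        using \<epsilon> T by (intro order_trans[OF abs_triangle_ineq]) (simp add: abs_mult)
      also have "\<dots> \<le> \<epsilon>0 * U n + sqrt T * U n"
        using \<epsilon> T V by (intro add_mono mult_mono) (auto simp: U)
      finally show ?thesis by (simp add: distrib_right)
    qed
    have "\<bar>\<delta> n\<bar> ^ 3 \<le> (h * sqrt h) * exp (3 * U n)"
    proof -
      have "\<bar>\<delta> n\<bar> ^ 3 \<le> (sqrt h * V) ^ 3" by (intro power_mono \<delta>) simp
      also have "\<dots> = h * sqrt h * V ^ 3" using hN(1) by (simp add: power_mult_distrib power3_eq_cube)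
      finally have cube: "\<bar>\<delta> n\<bar> ^ 3 \<le> h * sqrt h * V ^ 3" .
      have "V \<le> exp (U n)" using exp_ge_add_one_self[of "U n"] V by linarith
      then have "V ^ 3 \<le> exp (U n) ^ 3" using V by (intro power_mono)
      also have "\<dots> = exp (3 * U n)" using exp_of_nat_mult[of 3 "U n"] by simp
      finally have "h * sqrt h * V ^ 3 \<le> h * sqrt h * exp (3 * U n)"
        using hN(1) by (intro mult_left_mono) auto
      with cube show ?thesis by linarith
    qed
    moreover have "C * \<bar>\<delta> n\<bar> \<le> C * sqrt T * U n"
    proof -
      have "\<bar>\<delta> n\<bar> \<le> sqrt T * U n"
        by (rule order_trans[OF \<delta> mult_mono]) (use hN T V in auto)
      then show ?thesis using C by (simp add: mult_left_mono mult.assoc)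
    qed
    moreover have "L * \<bar>\<Sum>k\<in>{Suc n..<N}. \<delta> k\<bar> \<le> L * (\<epsilon>0 + sqrt T) * U n"
      using mult_left_mono[OF S L_nonneg] by (simp add: mult.assoc)
    ultimately have "C * \<bar>\<delta> n\<bar> ^ 3 * exp (C * \<bar>\<delta> n\<bar>) * exp (L * \<bar>\<Sum>k\<in>{Suc n..<N}. \<delta> k\<bar>)
        \<le> C * ((h * sqrt h) * exp (3 * U n)) * exp (C * sqrt T * U n) * exp (L * (\<epsilon>0 + sqrt T) * U n)"
      using C hN by (intro mult_mono mult_left_mono) auto
    also have "\<dots> = C * (h * sqrt h) * exp (\<rho> * U n)"
      by (simp only: \<rho>_def distrib_right[of _ _ "U n"] exp_add mult.assoc)
    finally show ?thesis .
  qed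
  have cont: "continuous_on {0..T} m"
    using m by (auto simp: ou_path_def intro: continuous_on_subset)
  have XT: "X T = \<phi> (integral {0..T} (\<lambda>s. m s / \<epsilon>)) x0"
    by (rule time_changed_solution_eq_flow)
      (use T \<epsilon> X cont in \<open>auto intro!: continuous_intros intro: continuous_on_subset\<close>)
  have Z: "integral {0..T} (\<lambda>s. m s / \<epsilon>) = \<epsilon> * (m0 - m T) + (b T - b 0)"
  proof -
    have "integral {0..T} (\<lambda>s. m s / \<epsilon>) = integral {0..T} m / \<epsilon>" by simp
    also have "\<dots> = \<epsilon> * (m0 - m T) + (b T - b 0)"
      using ou_path_integral[OF m \<epsilon>(1), of 0 T] T \<epsilon> ou_path_initial[OF m]
      by (simp add: power2_eq_square field_simps)
    finally show ?thesis .
  qed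
  have Z': "(\<Sum>n<N. \<delta> n) = \<epsilon> * (m0 - x N) + (b T - b 0)"
    using implicit_euler_drift_sum[OF \<epsilon>(1) hN(1), of 0 N m0 b]
    by (simp add: \<delta>_def x_def hN lessThan_atLeast0)
  have "dist (Y N) (\<phi> (\<Sum>n<N. \<delta> n) (Y 0)) \<le> (\<Sum>n<N. C * (h * sqrt h) * exp (\<rho> * U n))"
    by (rule order_trans[OF integrator_global_error[OF local_error] sum_mono])
      (use step_le Y(2) in \<open>auto simp: \<delta>_def x_def\<close>)
  \<comment> \<open>The noise increments of the two random times cancel, leaving only the terminal
    difference \<open>\<epsilon> * (m T - x N)\<close>.\<close>
  moreover have "dist (\<phi> (\<Sum>n<N. \<delta> n) (Y 0)) (X T) \<le> B * \<bar>\<epsilon> * (m T - x N)\<bar>"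
    unfolding XT Z Z' Y(1) by (rule order_trans[OF flow_lipschitz_time]) (simp add: algebra_simps)
  ultimately have "dist (Y N) (X T) \<le> (\<Sum>n<N. C * (h * sqrt h) * exp (\<rho> * U n)) + B * \<bar>\<epsilon> * (m T - x N)\<bar>"
    using dist_triangle[of "Y N" "X T" "\<phi> (\<Sum>n<N. \<delta> n) (Y 0)"] by linarith
  then have "dist (Y N) (X T) / sqrt h
      \<le> ((\<Sum>n<N. C * (h * sqrt h) * exp (\<rho> * U n)) + B * \<bar>\<epsilon> * (m T - x N)\<bar>) / sqrt h"
    using hN by (intro divide_right_mono) auto
  also have "\<dots> = C * h * (\<Sum>n<N. exp (\<rho> * U n)) + B * \<bar>\<epsilon> * (m T - x N) / sqrt h\<bar>"
    using hN by (simp add: add_divide_distrib sum_distrib_left[symmetric])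
  also have "C * h * (\<Sum>n<N. exp (\<rho> * U n)) = C * T * ((\<Sum>n<N. exp (\<rho> * U n)) / real N)"
    by (simp add: h)
  finally show ?thesis by (simp only: U_def x_def hN(2))
qed

text \<open>Jensen's inequality for the power \<open>p\<close>: exponential moments of single steps
  suffice, with a constant free of \<open>N\<close>.\<close>

lemma average_exp_powr_le:
  fixes u :: "nat \<Rightarrow> real"
  assumes p: "1 \<le> p" and N: "1 \<le> N"
  shows "((\<Sum>n<N. exp (\<rho> * u n)) / real N) powr p \<le> (\<Sum>n<N. 1 / real N * exp (p * \<rho> * u n))"
proof -
  have "(\<Sum>n<N. (1 / real N) *\<^sub>R exp (\<rho> * u n)) powr p \<le> (\<Sum>n<N. 1 / real N * (exp (\<rho> * u n) powr p))"
    by (rule convex_on_sum[OF _ _ powr_convex[OF p]]) (use N in \<open>auto simp: lessThan_empty_iff\<close>)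
  then show ?thesis by (simp add: powr_def sum_divide_distrib mult.assoc)
qed

section \<open>From pathwise bounds to moments of order \<open>p\<close>\<close>

context prob_space
begin

text \<open>No measurability is assumed: a nonintegrable function has Bochner integral 0.\<close>

lemma expectation_le_nn_integral:
  assumes f: "\<And>\<omega>. 0 \<le> f \<omega>" and le: "(\<integral>\<^sup>+\<omega>. ennreal (f \<omega>) \<partial>M) \<le> ennreal c" and c: "0 \<le> c"
  shows "expectation f \<le> c"
proof (cases "integrable M f")
  case True
  then have "ennreal (expectation f) \<le> ennreal c"
    using le f by (simp add: nn_integral_eq_integral)
  then show ?thesis using c by simp
qed (simp add: c not_integrable_integral_eq)

text \<open>The two summands are separated at the cost of \<open>2 powr p\<close>; the average is
  handled by \<open>average_exp_powr_le\<close>, and the last term by \<open>\<bar>E \<omega>\<bar>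
  powr p \<le> exp (p * \<bar>E \<omega>\<bar>)\<close>. The weights \<open>1 / real N\<close> keep
  the result independent of \<open>N\<close>.\<close>

lemma nn_integral_powr_le:
  assumes U: "\<And>n. n < N \<Longrightarrow> exp_moments_le M (U n) \<kappa>" and E: "exp_moments_le M E \<mu>"
    and p: "1 \<le> p" and N: "1 \<le> N" and pos: "0 \<le> a" "0 \<le> b" "0 \<le> \<rho>"
    and D: "\<And>\<omega>. 0 \<le> D \<omega>"
    and le: "AE \<omega> in M. D \<omega> \<le> a * ((\<Sum>n<N. exp (\<rho> * \<bar>U n \<omega>\<bar>)) / real N) + b * \<bar>E \<omega>\<bar>"
  shows "(\<integral>\<^sup>+\<omega>. ennreal (D \<omega> powr p) \<partial>M)
    \<le> ennreal (2 powr p * (a powr p * \<kappa> (p * \<rho>) + b powr p * \<mu> p))"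
proof -
  have bound: "D \<omega> powr p \<le> (\<Sum>n<N. 2 powr p * a powr p / real N * exp (p * \<rho> * \<bar>U n \<omega>\<bar>))
      + 2 powr p * b powr p * exp (p * \<bar>E \<omega>\<bar>)"
    if "D \<omega> \<le> a * ((\<Sum>n<N. exp (\<rho> * \<bar>U n \<omega>\<bar>)) / real N) + b * \<bar>E \<omega>\<bar>" for \<omega>
  proof -
    let ?A = "(\<Sum>n<N. exp (\<rho> * \<bar>U n \<omega>\<bar>)) / real N"
    have A: "0 \<le> ?A" by (intro divide_nonneg_nonneg sum_nonneg) auto
    have two: "(x + y) powr p \<le> 2 powr p * (x powr p + y powr p)" if "0 \<le> x" "0 \<le> y" for x y :: real
    proof -
      have "(x + y) powr p \<le> (2 * max x y) powr p" using that p by (intro powr_mono2) auto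
      also have "\<dots> = 2 powr p * max x y powr p" using that by (simp add: powr_mult)
      also have "max x y powr p \<le> x powr p + y powr p" by (simp add: max_def)
      finally show ?thesis by simp
    qed
    have "D \<omega> powr p \<le> (a * ?A + b * \<bar>E \<omega>\<bar>) powr p"
      using that D p by (intro powr_mono2) auto
    also have "\<dots> \<le> 2 powr p * ((a * ?A) powr p + (b * \<bar>E \<omega>\<bar>) powr p)"
      using pos A by (intro two mult_nonneg_nonneg) auto
    also have "\<dots> = 2 powr p * (a powr p * ?A powr p + b powr p * \<bar>E \<omega>\<bar> powr p)"
      using pos A by (simp only: powr_mult)
    also have "\<dots> \<le> 2 powr p * (a powr p * (\<Sum>n<N. 1 / real N * exp (p * \<rho> * \<bar>U n \<omega>\<bar>)) + b powr p * exp (p * \<bar>E \<omega>\<bar>))"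
    proof (intro mult_left_mono add_mono average_exp_powr_le p N)
      have "\<bar>E \<omega>\<bar> \<le> exp \<bar>E \<omega>\<bar>" using exp_ge_add_one_self[of "\<bar>E \<omega>\<bar>"] by linarith
      then have "\<bar>E \<omega>\<bar> powr p \<le> exp \<bar>E \<omega>\<bar> powr p" using p by (intro powr_mono2) auto
      then show "\<bar>E \<omega>\<bar> powr p \<le> exp (p * \<bar>E \<omega>\<bar>)" by (simp add: powr_def)
    qed auto
    finally show ?thesis by (simp add: distrib_left sum_distrib_left mult.assoc)
  qed
  note [measurable] = exp_moments_leD(1)[OF E]
  have [measurable]: "n < N \<Longrightarrow> U n \<in> borel_measurable M" for n by (rule exp_moments_leD(1)[OF U])
  have c: "0 \<le> p" "0 \<le> p * \<rho>" using p pos by auto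
  have \<kappa>: "0 \<le> \<kappa> (p * \<rho>)" using exp_moments_le_ge_1[OF U[of 0] c(2)] N by simp
  have \<mu>: "0 \<le> \<mu> p" using exp_moments_le_ge_1[OF E c(1)] by simp
  have "(\<integral>\<^sup>+\<omega>. ennreal (D \<omega> powr p) \<partial>M) \<le> (\<integral>\<^sup>+\<omega>.
      (\<Sum>n<N. ennreal (2 powr p * a powr p / real N) * ennreal (exp (p * \<rho> * \<bar>U n \<omega>\<bar>)))
      + ennreal (2 powr p * b powr p) * ennreal (exp (p * \<bar>E \<omega>\<bar>)) \<partial>M)"
  proof (rule nn_integral_mono_AE, use le in eventually_elim)
    fix \<omega> assume "D \<omega> \<le> a * ((\<Sum>n<N. exp (\<rho> * \<bar>U n \<omega>\<bar>)) / real N) + b * \<bar>E \<omega>\<bar>"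
    from ennreal_leI[OF bound[OF this]]
    show "ennreal (D \<omega> powr p) \<le> (\<Sum>n<N. ennreal (2 powr p * a powr p / real N) * ennreal (exp (p * \<rho> * \<bar>U n \<omega>\<bar>)))
      + ennreal (2 powr p * b powr p) * ennreal (exp (p * \<bar>E \<omega>\<bar>))"
      by (simp add: ennreal_plus sum_nonneg flip: ennreal_mult sum_ennreal)
  qed
  also have "\<dots> = (\<Sum>n<N. ennreal (2 powr p * a powr p / real N) * (\<integral>\<^sup>+\<omega>. ennreal (exp (p * \<rho> * \<bar>U n \<omega>\<bar>)) \<partial>M))
      + ennreal (2 powr p * b powr p) * (\<integral>\<^sup>+\<omega>. ennreal (exp (p * \<bar>E \<omega>\<bar>)) \<partial>M)"
    by (subst nn_integral_add, measurable, subst nn_integral_sum, measurable)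
      (auto intro!: sum.cong nn_integral_cmult arg_cong2[where f = "(+)"])
  also have "\<dots> \<le> (\<Sum>n<N. ennreal (2 powr p * a powr p / real N) * ennreal (\<kappa> (p * \<rho>)))
      + ennreal (2 powr p * b powr p) * ennreal (\<mu> p)"
    by (intro add_mono sum_mono mult_left_mono exp_moments_leD(2)[OF U] exp_moments_leD(2)[OF E] c) auto
  also have "\<dots> = ennreal (2 powr p * (a powr p * \<kappa> (p * \<rho>) + b powr p * \<mu> p))"
    using N \<kappa> \<mu> by (simp add: distrib_left ennreal_of_nat_eq_real_of_nat mult.assoc flip: ennreal_mult ennreal_plus)
  finally show ?thesis .
qed

end

text \<open>The four Euler values pass through three rounds of pairwise addition, hence the order
  \<open>8 * c\<close>; the two Wiener increments pass through two, hence
  \<open>4 * c\<close>.\<close>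

lemma (in ou) exp_moments_path_size:
  assumes h: "0 < h" and n: "n < N"
  shows "exp_moments_le M (\<lambda>\<omega>. path_size \<epsilon> h m0 (\<lambda>t. \<beta> t \<omega>) N n)
    (\<lambda>c. 4 * gaussian_moments K (8 * c) + 2 * gaussian_moments 0 (4 * c))"
proof -
  let ?s = "real n * h" and ?t = "real (Suc n) * h" and ?T = "real N * h"
  have tT: "?t \<le> ?T" using h n by (intro mult_right_mono) auto
  have st: "0 \<le> ?s" "?s \<le> ?t" "0 < ?T" "?t - ?s = h" "0 \<le> ?t" "0 \<le> ?T"
    using h n by (auto simp: distrib_right)
  note x = exp_moments_implicit_euler[OF \<epsilon> h K]
  have W: "exp_moments_le M (\<lambda>\<omega>. (\<beta> ?t \<omega> - \<beta> ?s \<omega>) / sqrt h) (gaussian_moments 0)"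
    by (rule exp_moments_wiener_increment) (use st h in auto)
  have W': "exp_moments_le M (\<lambda>\<omega>. (\<beta> ?T \<omega> - \<beta> ?t \<omega>) / sqrt ?T) (gaussian_moments 0)"
    by (rule exp_moments_wiener_increment) (use st tT in auto)
  note [measurable] = exp_moments_leD(1)[OF x] exp_moments_leD(1)[OF W] exp_moments_leD(1)[OF W']
  have x2: "exp_moments_le M (\<lambda>\<omega>. \<bar>euler h i \<omega>\<bar> + \<bar>euler h j \<omega>\<bar>)
      (\<lambda>c. gaussian_moments K (2 * c) + gaussian_moments K (2 * c))" for i j
    by (rule exp_moments_le_add[OF x x]) auto
  have x4: "exp_moments_le M (\<lambda>\<omega>. (\<bar>euler h n \<omega>\<bar> + \<bar>euler h (Suc n) \<omega>\<bar>) + (\<bar>euler h (Suc n) \<omega>\<bar> + \<bar>euler h N \<omega>\<bar>))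
      (\<lambda>c. (gaussian_moments K (2 * (2 * c)) + gaussian_moments K (2 * (2 * c)))
        + (gaussian_moments K (2 * (2 * c)) + gaussian_moments K (2 * (2 * c))))"
    by (rule exp_moments_le_add[OF x2[of n "Suc n"] x2[of "Suc n" N]]) (auto simp del: implicit_euler.simps)
  have W2: "exp_moments_le M (\<lambda>\<omega>. \<bar>(\<beta> ?t \<omega> - \<beta> ?s \<omega>) / sqrt h\<bar> + \<bar>(\<beta> ?T \<omega> - \<beta> ?t \<omega>) / sqrt ?T\<bar>)
      (\<lambda>c. gaussian_moments 0 (2 * c) + gaussian_moments 0 (2 * c))"
    by (rule exp_moments_le_add[OF W W'])
      (intro borel_measurable_add borel_measurable_abs exp_moments_leD(1)[OF W] exp_moments_leD(1)[OF W'], simp)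
  have "exp_moments_le M (\<lambda>\<omega>. path_size \<epsilon> h m0 (\<lambda>t. \<beta> t \<omega>) N n)
      (\<lambda>c. ((gaussian_moments K (2 * (2 * (2 * c))) + gaussian_moments K (2 * (2 * (2 * c))))
        + (gaussian_moments K (2 * (2 * (2 * c))) + gaussian_moments K (2 * (2 * (2 * c)))))
        + (gaussian_moments 0 (2 * (2 * c)) + gaussian_moments 0 (2 * (2 * c))))"
    unfolding path_size_def Let_def
    by (rule exp_moments_le_add[OF x4 W2])
      (use exp_moments_leD(1)[OF x4] exp_moments_leD(1)[OF W2] in
        \<open>auto simp del: implicit_euler.simps of_nat_Suc intro!: borel_measurable_add\<close>)
  then show ?thesis by simp
qed

section \<open>Reduction of the given processes to their pathwise forms\<close>

lemma second_order_integrator_local_error: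
  assumes "second_order_integrator \<phi> \<Phi>"
  obtains C where "0 < C" "\<And>t x. dist (\<Phi> t x) (\<phi> t x) \<le> C * \<bar>t\<bar> ^ 3 * exp (C * \<bar>t\<bar>)"
  using assms unfolding second_order_integrator_def by metis

text \<open>The implicit equation is linear with coefficient
  \<open>1 + h / \<epsilon>\<^sup>2 > 0\<close>, so it determines the new value.\<close>

lemma numerical_scheme_eq_implicit_euler:
  assumes scheme: "numerical_scheme M \<beta> \<Phi> \<epsilon> h x0 m0 X m" and h: "0 < h" and \<omega>: "\<omega> \<in> space M"
  shows "m n \<omega> = implicit_euler \<epsilon> h m0 (\<lambda>t. \<beta> t \<omega>) n"
proof (induction n)
  case 0
  then show ?case using scheme \<omega> by (simp add: numerical_scheme_def)
next
  case (Suc n)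
  have pos: "0 < 1 + h / \<epsilon>\<^sup>2" using h by (intro add_pos_nonneg) auto
  have "m (Suc n) \<omega> = m n \<omega> - h / \<epsilon>\<^sup>2 * m (Suc n) \<omega>
      + (\<beta> (real (Suc n) * h) \<omega> - \<beta> (real n * h) \<omega>) / \<epsilon>"
    using scheme \<omega> unfolding numerical_scheme_def by blast
  then have "m (Suc n) \<omega> * (1 + h / \<epsilon>\<^sup>2) = m n \<omega> + (\<beta> (real (Suc n) * h) \<omega> - \<beta> (real n * h) \<omega>) / \<epsilon>"
    by (simp add: algebra_simps)
  then have "m (Suc n) \<omega> = (m n \<omega> + (\<beta> (real (Suc n) * h) \<omega> - \<beta> (real n * h) \<omega>) / \<epsilon>) / (1 + h / \<epsilon>\<^sup>2)"
    using pos by (simp add: eq_divide_eq del: of_nat_Suc)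
  then show ?case by (simp only: implicit_euler.simps Suc)
qed

lemma multiscale_solution_ou_path:
  assumes "multiscale_solution M F \<beta> \<sigma> \<epsilon> x0 m0 X m"
  shows "AE \<omega> in M. ou_path \<epsilon> m0 (\<lambda>t. \<beta> t \<omega>) (\<lambda>t. m t \<omega>)"
proof -
  have "AE \<omega> in M.
        continuous_on {0..} (\<lambda>t. X t \<omega>) \<and> continuous_on {0..} (\<lambda>t. m t \<omega>) \<and>
        (\<forall>t\<ge>0.
           X t \<omega> = x0 + to_torus (integral {0..t} (\<lambda>s. (m s \<omega> / \<epsilon>) *\<^sub>R \<sigma> (X s \<omega>))) \<and>
           m t \<omega> = m0 - integral {0..t} (\<lambda>s. m s \<omega> / \<epsilon>\<^sup>2) + (\<beta> t \<omega> - \<beta> 0 \<omega>) / \<epsilon>)"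
    using assms by (simp only: multiscale_solution_def)
  then show ?thesis by eventually_elim (unfold ou_path_def, blast)
qed

theorem theorem3p3:
  fixes \<sigma> :: "'d::finite torus \<Rightarrow> real ^ 'd"
    and \<phi> \<Phi> :: "real \<Rightarrow> 'd torus \<Rightarrow> 'd torus"
    and \<epsilon>0 :: real
    and N0 :: nat
    and M :: "'w measure"
    and F :: "real \<Rightarrow> 'w measure"
    and \<beta> :: "real \<Rightarrow> 'w \<Rightarrow> real"
    and x0 :: "real \<Rightarrow> 'd torus" and x00 :: "'d torus"
    and m0 :: "real \<Rightarrow> real"
    and X :: "real \<Rightarrow> real \<Rightarrow> 'w \<Rightarrow> 'd torus"
    and m :: "real \<Rightarrow> real \<Rightarrow> 'w \<Rightarrow> real"
    and Xnum :: "real \<Rightarrow> real \<Rightarrow> nat \<Rightarrow> 'w \<Rightarrow> 'd torus"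
    and mnum :: "real \<Rightarrow> real \<Rightarrow> nat \<Rightarrow> 'w \<Rightarrow> real"
  assumes "\<epsilon>0 > 0" and "N0 \<ge> 1"
    and "C_k_torus 3 \<sigma>"
    and "torus_flow \<sigma> \<phi>"
    and "second_order_integrator \<phi> \<Phi>"
    and "usual_conditions M F"
    and "wiener_process M F \<beta>"
    and "(x0 \<longlongrightarrow> x00) (at_right 0)"
    and "bdd_above ((\<lambda>\<epsilon>. \<bar>m0 \<epsilon>\<bar>) ` {0<..<\<epsilon>0})"
    and "\<And>\<epsilon>. \<epsilon> \<in> {0<..<\<epsilon>0} \<Longrightarrow>
           multiscale_solution M F \<beta> \<sigma> \<epsilon> (x0 \<epsilon>) (m0 \<epsilon>) (X \<epsilon>) (m \<epsilon>)"
    and "\<And>\<epsilon> \<Delta>t. \<epsilon> \<in> {0<..<\<epsilon>0} \<Longrightarrow> \<Delta>t > 0 \<Longrightarrow>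
           numerical_scheme M \<beta> \<Phi> \<epsilon> \<Delta>t (x0 \<epsilon>) (m0 \<epsilon>) (Xnum \<epsilon> \<Delta>t) (mnum \<epsilon> \<Delta>t)"
  shows "\<forall>T>0. \<forall>p\<ge>1. \<exists>C>0. \<forall>N\<ge>1. \<forall>\<Delta>t. \<Delta>t = T / real N \<and> \<Delta>t \<in> {0<..<T / real N0} \<longrightarrow>
           (SUP \<epsilon>\<in>{0<..<\<epsilon>0}.
              ereal ((prob_space.expectation M
                (\<lambda>\<omega>. dist (Xnum \<epsilon> \<Delta>t N \<omega>) (X \<epsilon> T \<omega>) powr p)) powr (1 / p)))
           \<le> ereal (C * \<Delta>t powr (1 / 2))"
proof (intro allI impI)
  fix T p :: real
  assume T: "0 < T" and p: "1 \<le> p"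
  have \<sigma>: "C_k_torus (Suc 2) \<sigma>" using assms(3) by (simp add: numeral_3_eq_3 numeral_2_eq_2)
  obtain L where L: "0 \<le> L" "\<And>x y. norm (\<sigma> (to_torus x) - \<sigma> (to_torus y)) \<le> L * norm (x - y)"
    using C_k_torus_lipschitz[OF \<sigma>] by metis
  have "continuous_on UNIV (\<lambda>x. \<sigma> (to_torus x))"
    using assms(3) unfolding C_k_torus_def by (rule C_k_imp_continuous)
  then obtain B where B: "0 \<le> B" "\<And>x. norm (\<sigma> (to_torus x)) \<le> B"
    by (rule torus_periodic_bounded) auto
  interpret flow: lipschitz_torus_flow \<sigma> \<phi> L B
    by unfold_locales (use assms(4) L B to_torus_surj in \<open>metis+\<close>)
  interpret wiener M F \<beta>
    by unfold_locales (use assms(6,7) in auto)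
  obtain C where C: "0 < C" "\<And>t x. dist (\<Phi> t x) (\<phi> t x) \<le> C * \<bar>t\<bar> ^ 3 * exp (C * \<bar>t\<bar>)"
    using second_order_integrator_local_error[OF assms(5)] by metis
  obtain K where K: "\<And>\<epsilon>. \<epsilon> \<in> {0<..<\<epsilon>0} \<Longrightarrow> \<bar>m0 \<epsilon>\<bar> \<le> K"
    using assms(9) unfolding bdd_above_def by (metis image_eqI)
  define \<rho> where "\<rho> = 3 + C * sqrt T + L * (\<epsilon>0 + sqrt T)"
  have \<rho>: "0 \<le> \<rho>" using C L T assms(1) by (simp add: \<rho>_def)
  define \<kappa> where "\<kappa> c = 4 * gaussian_moments K (8 * c) + 2 * gaussian_moments 0 (4 * c)" for c
  \<comment> \<open>The bound of \<open>nn_integral_powr_le\<close> for the error divided by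
    \<open>sqrt h\<close>, with weight \<open>C * T\<close> on the local errors and \<open>B\<close>
    on the terminal difference.\<close>
  define Q where "Q = 2 powr p * ((C * T) powr p * \<kappa> (p * \<rho>) + B powr p * increment_moments K p)"
  have Q: "0 \<le> Q" unfolding Q_def \<kappa>_def increment_moments_def gaussian_moments_def
    by (intro mult_nonneg_nonneg add_nonneg_nonneg) auto
  \<comment> \<open>\<open>K\<close>, \<open>\<rho>\<close> and \<open>Q\<close> are fixed before
    \<open>N\<close> and \<open>\<epsilon>\<close>, which yields the uniformity. Adding 1 makes the
    constant strictly positive.\<close>
  have main: "expectation (\<lambda>\<omega>. dist (Xnum \<epsilon> h N \<omega>) (X \<epsilon> T \<omega>) powr p) powr (1 / p)
      \<le> (Q powr (1 / p) + 1) * h powr (1 / 2)"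
    if N: "1 \<le> N" and hT: "h = T / real N" and \<epsilon>: "\<epsilon> \<in> {0<..<\<epsilon>0}" for N h \<epsilon>
  proof -
    have h: "0 < h" "real N * h = T" using N T hT by auto
    have \<epsilon>0: "0 < \<epsilon>" "\<epsilon> \<le> \<epsilon>0" using \<epsilon> by auto
    note sol = assms(10)[OF \<epsilon>] and scheme = assms(11)[OF \<epsilon> h(1)]
    interpret ou M F \<beta> \<epsilon> "m0 \<epsilon>" K "m \<epsilon>"
    proof
      show "m \<epsilon> t \<in> borel_measurable M" if "0 \<le> t" for t
        using sol that by (intro measurable_F[of _ t]) (auto simp: multiscale_solution_def)
    qed (use \<epsilon>0 K[OF \<epsilon>] multiscale_solution_ou_path[OF sol] in auto)
    let ?D = "\<lambda>\<omega>. dist (Xnum \<epsilon> h N \<omega>) (X \<epsilon> T \<omega>)"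
    let ?U = "\<lambda>n \<omega>. path_size \<epsilon> h (m0 \<epsilon>) (\<lambda>t. \<beta> t \<omega>) N n"
    let ?E = "\<lambda>\<omega>. \<epsilon> * (m \<epsilon> (real N * h) \<omega> - euler h N \<omega>) / sqrt h"
    have "AE \<omega> in M.
        continuous_on {0..} (\<lambda>t. X \<epsilon> t \<omega>) \<and> continuous_on {0..} (\<lambda>t. m \<epsilon> t \<omega>) \<and>
        (\<forall>t\<ge>0.
           X \<epsilon> t \<omega> = x0 \<epsilon> + to_torus (integral {0..t} (\<lambda>s. (m \<epsilon> s \<omega> / \<epsilon>) *\<^sub>R \<sigma> (X \<epsilon> s \<omega>))) \<and>
           m \<epsilon> t \<omega> = m0 \<epsilon> - integral {0..t} (\<lambda>s. m \<epsilon> s \<omega> / \<epsilon>\<^sup>2) + (\<beta> t \<omega> - \<beta> 0 \<omega>) / \<epsilon>)"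
      using sol by (simp only: multiscale_solution_def)
    then have "AE \<omega> in M. ?D \<omega> / sqrt h \<le> C * T * ((\<Sum>n<N. exp (\<rho> * \<bar>?U n \<omega>\<bar>)) / real N) + B * \<bar>?E \<omega>\<bar>"
      using path AE_space
    proof eventually_elim
      case (elim \<omega>)
      have "Xnum \<epsilon> h 0 \<omega> = x0 \<epsilon>"
        "Xnum \<epsilon> h (Suc n) \<omega> = \<Phi> (h * implicit_euler \<epsilon> h (m0 \<epsilon>) (\<lambda>t. \<beta> t \<omega>) (Suc n) / \<epsilon>) (Xnum \<epsilon> h n \<omega>)" for n
        using scheme elim(3) numerical_scheme_eq_implicit_euler[OF scheme h(1) elim(3), of "Suc n"]
        unfolding numerical_scheme_def by metis+
      then have "?D \<omega> / sqrt h \<le> C * T * ((\<Sum>n<N. exp (\<rho> * ?U n \<omega>)) / real N) + B * \<bar>?E \<omega>\<bar>"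
        unfolding \<rho>_def
        by (intro flow.scheme_error_pathwise[OF \<epsilon>0 T N hT less_imp_le[OF C(1)] C(2) elim(2)])
          (use elim(1) in blast)+
      \<comment> \<open>Path sizes are nonnegative, so the absolute values expected by
        \<open>nn_integral_powr_le\<close> change nothing.\<close>
      moreover have "0 \<le> ?U n \<omega>" for n by (simp add: path_size_def Let_def)
      ultimately show ?case by simp
    qed
    then have "(\<integral>\<^sup>+\<omega>. ennreal ((?D \<omega> / sqrt h) powr p) \<partial>M) \<le> ennreal Q"
      unfolding Q_def \<kappa>_def
      by (rule nn_integral_powr_le[rotated -1])
        (use exp_moments_path_size exp_moments_euler_error h C T B \<rho> p N in auto)
    then have "expectation (\<lambda>\<omega>. (?D \<omega> / sqrt h) powr p) \<le> Q"
      by (intro expectation_le_nn_integral Q) auto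
    \<comment> \<open>The deterministic factor \<open>h powr (p / 2)\<close> leaves the expectation
      and becomes the rate \<open>h powr (1 / 2)\<close> after the \<open>p\<close>-th root.\<close>
    moreover have "?D \<omega> powr p = h powr (p / 2) * (?D \<omega> / sqrt h) powr p" for \<omega>
    proof -
      have "?D \<omega> = h powr (1 / 2) * (?D \<omega> / sqrt h)" using h by (simp add: powr_half_sqrt)
      then have "?D \<omega> powr p = (h powr (1 / 2) * (?D \<omega> / sqrt h)) powr p" by presburger
      also have "\<dots> = h powr (p / 2) * (?D \<omega> / sqrt h) powr p"
        using h by (subst powr_mult) (auto simp: powr_powr)
      finally show ?thesis .
    qed
    ultimately have "expectation (\<lambda>\<omega>. ?D \<omega> powr p) \<le> h powr (p / 2) * Q"
      by (simp add: mult_left_mono)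
    then have "expectation (\<lambda>\<omega>. ?D \<omega> powr p) powr (1 / p) \<le> (h powr (p / 2) * Q) powr (1 / p)"
      using p by (intro powr_mono2 integral_nonneg) auto
    also have "\<dots> = Q powr (1 / p) * h powr (1 / 2)"
      using Q h p by (simp add: powr_mult powr_powr)
    also have "\<dots> \<le> (Q powr (1 / p) + 1) * h powr (1 / 2)" by (intro mult_right_mono) auto
    finally show ?thesis .
  qed
  show "\<exists>C>0. \<forall>N\<ge>1. \<forall>\<Delta>t. \<Delta>t = T / real N \<and> \<Delta>t \<in> {0<..<T / real N0} \<longrightarrow>
      (SUP \<epsilon>\<in>{0<..<\<epsilon>0}. ereal (expectation (\<lambda>\<omega>. dist (Xnum \<epsilon> \<Delta>t N \<omega>) (X \<epsilon> T \<omega>) powr p) powr (1 / p)))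
        \<le> ereal (C * \<Delta>t powr (1 / 2))"
  proof (intro exI[of _ "Q powr (1 / p) + 1"] conjI allI impI SUP_least)
    show "0 < Q powr (1 / p) + 1" by (simp add: add_nonneg_pos)
  qed (use main in auto)
qed

end
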